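(* Assume that the moving boundary $t\mapsto A_t$ is periodic, i.e. there is $\gamma>0$ with $A_{t+\gamma}=A_t$ for all $t$. Assume moreover that there exist probability measures $(\nu_s)_{s\in I}$ with $\nu_s\in\mathcal M_1(E_s)$ for each $s\in I$, and constants $t_0\in I$, $t_0>0$, $c_1>0$, $c_2>0$, such that (A'1) for all $s\in I$ and $x\in E_s$, $\mathbb P_{s,x}(X_{s+t_0}\in\cdot\mid\tau_A>s+t_0)\ge c_1\,\nu_{s+t_0}$; (A'2) for all $s\le t$ in $I$ and all $x\in E_s$, $\mathbb P_{s,\nu_s}(\tau_A>t)\ge c_2\,\mathbb P_{s,x}(\tau_A>t)$. Then there exists a unique probability measure $\beta$ on $E$ such that, for every $\mu\in\mathcal M_1(E_0)$, $$\frac1t\int_0^t\mathbb P_\mu(X_s\in\cdot\mid\tau_A>t)\,ds\longrightarrow\beta\quad\text{weakly as }t\to\infty.$$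
   Context: Here $I=\mathbb R_+$ (when $I=\mathbb Z_+$, $\gamma$ is a positive integer and the time average is read as $\frac1n\sum_{k=0}^n\mathbb P_\mu(X_k\in\cdot\mid\tau_A>n)$, $n\to\infty$). $(X_t)_{t\in I}$ is a time-homogeneous Markov process on a metric space $(E,d)$ equipped with a $\sigma$-algebra $\mathcal E$, and $\mathcal F_t=\sigma(X_u,\,0\le u\le t)$. For $s\in I$, $x\in E$, $\mathbb P_{s,x}$ is the law of the process started from $x$ at time $s$ ($\mathbb P_{s,x}(X_s=x)=1$; by time-homogeneity $(X_{s+u})_{u\in I}$ under $\mathbb P_{s,x}$ has the law of $(X_u)_{u\in I}$ under $\mathbb P_{0,x}$). For a measure $\mu$ put $\mathbb P_{s,\mu}=\int\mathbb P_{s,x}\,\mu(dx)$ and $\mathbb P_\mu=\mathbb P_{0,\mu}$. For $F\subset E$, $\mathcal M_1(F)$ is the set of probability measures on $F$. For each $t\in I$, $A_t\in\mathcal E$ is the absorbing subset at time $t$, $E_t=E\setminus A_t$, and $\tau_A=\inf\{t\in I: X_t\in A_t\}$ (under $\mathbb P_{s,\cdot}$ the infimum is over $t\ge s$). It is assumed throughout that $\tau_A$ is an $(\mathcal F_t)$-stopping time, that $\mathbb P_{s,x}(\tau_A<\infty)=1$ for all $s\in I$, $x\in E_s$, and that $\mathbb P_{s,x}(\tau_A>t)>0$ for all $s\le t$, $x\in E_s$. An inequality between measures is meant setwise. *)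

theory Defs
  imports "HOL-Probability.Probability"
begin

text \<open>The time set \<open>I\<close> is a subset of the reals, either \<open>{0..}\<close> or \<open>\<nat>\<close>.  The state space is the
  whole type \<open>'a\<close> with \<open>\<sigma>\<close>-algebra \<open>E\<close>, which contains the Borel sets of the metric.  Only the
  \<open>\<sigma>\<close>-algebra of the sample space \<open>\<Omega>\<close> matters; the laws on it are the measures \<open>P s x\<close>.\<close>

definition sigma_gen_by ::
  "'w measure \<Rightarrow> 'a measure \<Rightarrow> (real \<Rightarrow> 'w \<Rightarrow> 'a) \<Rightarrow> real set \<Rightarrow> 'w measure" where
  "sigma_gen_by \<Omega> E X J = sigma (space \<Omega>) {X v -` B \<inter> space \<Omega> | v B. v \<in> J \<and> B \<in> sets E}"

text \<open>The \<open>time_homogeneous\<close> assumption says that \<open>(X (s + u))\<^sub>u\<close> under \<open>P s x\<close> and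
  \<open>(X (s' + u))\<^sub>u\<close> under \<open>P s' x\<close> have the same law, where the law is evaluated on every set \<open>D\<close> of
  paths for which both preimages are events of the process, not only on the product
  \<open>\<sigma>\<close>-algebra.  In continuous time, equality on the product \<open>\<sigma>\<close>-algebra alone would leave the laws
  of the hitting times unrelated when the sample paths of the two processes have different
  regularity, because a hitting time is an infimum over uncountably many times.  If there are shift
  operators \<open>\<theta> s\<close> on \<open>\<Omega>\<close> with \<open>X u (\<theta> s \<omega>) = X (s + u) \<omega>\<close> such that \<open>\<theta> s\<close> maps \<open>P s x\<close> to \<open>P 0 x\<close>
  on the events generated by \<open>X\<close>, the assumption holds.\<close>

locale homogeneous_markov_process =
  fixes I :: "real set"
    and E :: "'a::metric_space measure"
    and \<Omega> :: "'w measure"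
    and X :: "real \<Rightarrow> 'w \<Rightarrow> 'a"
    and P :: "real \<Rightarrow> 'a \<Rightarrow> 'w measure"
  assumes time_set: "I = {0..} \<or> I = \<nat>"
    and space_E: "space E = UNIV"
    and borel_subset_E: "sets borel \<subseteq> sets E"
    and X_measurable: "\<And>t. t \<in> I \<Longrightarrow> X t \<in> \<Omega> \<rightarrow>\<^sub>M E"
    and kernel: "\<And>s. s \<in> I \<Longrightarrow> P s \<in> E \<rightarrow>\<^sub>M prob_algebra \<Omega>"
    and start: "\<And>s x. s \<in> I \<Longrightarrow> \<P>(\<omega> in P s x. X s \<omega> = x) = 1"
    and markov: "\<And>s u x G. s \<in> I \<Longrightarrow> u \<in> I \<Longrightarrow> s \<le> u \<Longrightarrow>
      G \<in> sets (sigma_gen_by \<Omega> E X (I \<inter> {u..})) \<Longrightarrow>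
      AE \<omega> in P s x.
        real_cond_exp (P s x) (sigma_gen_by \<Omega> E X (I \<inter> {s..u})) (indicator G) \<omega>
          = measure (P u (X u \<omega>)) G"
    and time_homogeneous: "\<And>s s' x D. s \<in> I \<Longrightarrow> s' \<in> I \<Longrightarrow>
      {\<omega> \<in> space \<Omega>. (\<lambda>u\<in>I. X (s + u) \<omega>) \<in> D} \<in> sets (sigma_gen_by \<Omega> E X (I \<inter> {s..})) \<Longrightarrow>
      {\<omega> \<in> space \<Omega>. (\<lambda>u\<in>I. X (s' + u) \<omega>) \<in> D} \<in> sets (sigma_gen_by \<Omega> E X (I \<inter> {s'..})) \<Longrightarrow>
      \<P>(\<omega> in P s x. (\<lambda>u\<in>I. X (s + u) \<omega>) \<in> D) = \<P>(\<omega> in P s' x. (\<lambda>u\<in>I. X (s' + u) \<omega>) \<in> D)"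

text \<open>\<open>absorption_time I A X s\<close> is \<open>\<tau>\<^sub>A\<close> as it is read under \<open>P s x\<close>, for the process started at
  time \<open>s\<close>; it is \<open>\<infinity>\<close> if \<open>A\<close> is never hit.\<close>

definition absorption_time ::
  "real set \<Rightarrow> (real \<Rightarrow> 'a set) \<Rightarrow> (real \<Rightarrow> 'w \<Rightarrow> 'a) \<Rightarrow> real \<Rightarrow> 'w \<Rightarrow> ereal" where
  "absorption_time I A X s \<omega> = Inf (ereal ` {t \<in> I. s \<le> t \<and> X t \<omega> \<in> A t})"

text \<open>Under \<open>P s x\<close> the process is only considered from time \<open>s\<close> on, so the natural filtration for
  which \<open>\<tau>\<^sub>A\<close> is a stopping time is the one generated by \<open>X u\<close> for \<open>s \<le> u \<le> t\<close>; for
  \<open>s = 0\<close> this is the usual one.\<close>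

locale absorbed_markov_process = homogeneous_markov_process I E \<Omega> X P
  for I :: "real set"
    and E :: "'a::metric_space measure"
    and \<Omega> :: "'w measure"
    and X :: "real \<Rightarrow> 'w \<Rightarrow> 'a"
    and P :: "real \<Rightarrow> 'a \<Rightarrow> 'w measure" +
  fixes A :: "real \<Rightarrow> 'a set"
  assumes A_measurable: "\<And>t. t \<in> I \<Longrightarrow> A t \<in> sets E"
    and stopping: "\<And>s t. s \<in> I \<Longrightarrow> t \<in> I \<Longrightarrow>
      {\<omega> \<in> space \<Omega>. absorption_time I A X s \<omega> \<le> ereal t}
        \<in> sets (sigma_gen_by \<Omega> E X (I \<inter> {s..t}))"
    and absorbed: "\<And>s x. s \<in> I \<Longrightarrow> x \<in> - A s \<Longrightarrow>
      \<P>(\<omega> in P s x. absorption_time I A X s \<omega> < \<infinity>) = 1"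
    and survival_pos: "\<And>s t x. s \<in> I \<Longrightarrow> t \<in> I \<Longrightarrow> s \<le> t \<Longrightarrow> x \<in> - A s \<Longrightarrow>
      \<P>(\<omega> in P s x. absorption_time I A X s \<omega> > ereal t) > 0"

text \<open>Probability measures on a measurable subset \<open>F\<close> are represented as probability measures on
  \<open>E\<close> that give mass 1 to \<open>F\<close>.\<close>

definition prob_measures_on :: "'a measure \<Rightarrow> 'a set \<Rightarrow> 'a measure set" where
  "prob_measures_on E F = {\<mu> \<in> space (prob_algebra E). emeasure \<mu> F = 1}"

text \<open>\<open>cond_marginal I A X Q s u t B\<close> is the probability of \<open>X u \<in> B\<close> given \<open>\<tau>\<^sub>A > t\<close> under a law
  \<open>Q\<close> of the process started at time \<open>s\<close>.\<close>

definition cond_marginal ::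
  "real set \<Rightarrow> (real \<Rightarrow> 'a set) \<Rightarrow> (real \<Rightarrow> 'w \<Rightarrow> 'a) \<Rightarrow> 'w measure \<Rightarrow> real \<Rightarrow> real \<Rightarrow> real
    \<Rightarrow> 'a set \<Rightarrow> real" where
  "cond_marginal I A X Q s u t B =
     \<P>(\<omega> in Q. X u \<omega> \<in> B \<bar> absorption_time I A X s \<omega> > ereal t)"

text \<open>In discrete time there are \<open>n + 1\<close> summands, so the total mass is \<open>(n + 1) / n\<close>.\<close>

definition time_average ::
  "real set \<Rightarrow> (real \<Rightarrow> 'a::metric_space set) \<Rightarrow> (real \<Rightarrow> 'w \<Rightarrow> 'a) \<Rightarrow> 'w measure \<Rightarrow> real
    \<Rightarrow> 'a measure" where
  "time_average I A X Q t = measure_of UNIV (sets borel) (\<lambda>B. ennreal (1 / t *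
     (if I = \<nat> then (\<Sum>k | k \<in> \<nat> \<and> k \<le> t. cond_marginal I A X Q 0 k t B)
      else (\<integral>s. cond_marginal I A X Q 0 s t B \<partial>lebesgue_on {0..t}))))"

definition converges_weakly ::
  "('t \<Rightarrow> 'a::metric_space measure) \<Rightarrow> 'a measure \<Rightarrow> 't filter \<Rightarrow> bool" where
  "converges_weakly m \<beta> \<F> \<longleftrightarrow> (\<forall>f :: 'a \<Rightarrow> real. continuous_on UNIV f \<longrightarrow> bounded (range f) \<longrightarrow>
     ((\<lambda>t. \<integral>x. f x \<partial>m t) \<longlongrightarrow> (\<integral>x. f x \<partial>\<beta>)) \<F>)"

end

theory Submission
  imports Defs
begin

text \<open>By (A'1) and (A'2), the process conditioned on survival up to a horizon \<open>T\<close> satisfies Doeblin's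
  condition over every time step of length \<open>t0\<close>, with the constant \<open>c1 * c2\<close>.  Hence its law
  \<open>F s T\<close> at time \<open>s\<close> forgets the initial law and the starting time exponentially fast in \<open>s\<close>.  The same
  contraction, applied to survival up to \<open>T' > T\<close>, shows that \<open>F s T\<close> forgets the horizon exponentially
  fast in \<open>T - s\<close>.  With the periodicity, the integral of \<open>F s T\<close> over \<open>s \<le> T\<close> is quasi-additive in
  \<open>T \<in> \<gamma> \<nat>\<close>, so the time averages converge at the rate \<open>1 / T\<close>, uniformly over all events.  The limit is
  therefore a probability measure, and the convergence is even in total variation.\<close>

section \<open>Measures and integrals\<close>

text \<open>The law of the process conditioned on survival up to \<open>T\<close> changes with
  \<open>T\<close>, so there is no single semigroup to contract. The estimates are therefore made
  before division: the probability of an event is squeezed between multiples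
  \<open>m * h r T x\<close> and \<open>M * h r T x\<close> of the survival probability, and each
  step of length \<open>t0\<close> shrinks \<open>M - m\<close> by the factor
  \<open>1 - c1 * c2\<close>. The constant is a product because (A'1) conditions only on survival up
  to the end of the step; weighting by the survival from there to \<open>T\<close> distorts the
  minorization, and (A'2) bounds the distortion by \<open>1 / c2\<close>. To change the horizon,
  survival up to \<open>T'\<close> is itself squeezed in this way, which makes
  \<open>h s T' / h s T\<close> nearly constant in the position, and a constant cancels in a
  conditional probability. Quasi-additivity of the integrals replaces an ergodic theorem: neither a
  limit process nor an invariant measure is built. Its constant depends on neither the event nor the
  initial law, so the averages converge uniformly over events and countable additivity survives the
  limit.\<close>

lemma uniform_setwise_limit:
  fixes M :: "nat \<Rightarrow> 'a measure"
  assumes fin: "\<And>n. finite_measure (M n)" and sets_M: "\<And>n. sets (M n) = sets N"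
    and Cauchy: "\<And>m n B. B \<in> sets N \<Longrightarrow> \<bar>measure (M m) B - measure (M n) B\<bar> \<le> e m + e n"
    and e: "e \<longlonglongrightarrow> 0"
    and mass: "(\<lambda>n. measure (M n) (space N)) \<longlonglongrightarrow> 1"
  obtains \<beta> where "prob_space \<beta>" "sets \<beta> = sets N"
    "\<And>n B. B \<in> sets N \<Longrightarrow> \<bar>measure (M n) B - measure \<beta> B\<bar> \<le> e n"
proof -
  define L where "L B = lim (\<lambda>n. measure (M n) B)" for B
  have lim: "(\<lambda>n. measure (M n) B) \<longlonglongrightarrow> L B" if B: "B \<in> sets N" for B
    unfolding L_def convergent_LIMSEQ_iff[symmetric]
  proof (rule Cauchy_convergent, rule CauchyI)
    fix r :: real assume "0 < r"
    then obtain n0 where n0: "\<And>n. n0 \<le> n \<Longrightarrow> \<bar>e n\<bar> < r / 2"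
      using LIMSEQ_D[OF e, of "r / 2"] by auto
    show "\<exists>n0. \<forall>m\<ge>n0. \<forall>n\<ge>n0. norm (measure (M m) B - measure (M n) B) < r"
    proof (intro exI[of _ n0] allI impI)
      fix m n assume "n0 \<le> m" "n0 \<le> n"
      then show "norm (measure (M m) B - measure (M n) B) < r"
        using Cauchy[OF B, of m n] n0[of m] n0[of n] by simp
    qed
  qed
  have bound: "\<bar>measure (M n) B - L B\<bar> \<le> e n" if B: "B \<in> sets N" for n B
  proof -
    have "(\<lambda>m. \<bar>measure (M n) B - measure (M m) B\<bar>) \<longlonglongrightarrow> \<bar>measure (M n) B - L B\<bar>"
      by (intro tendsto_intros lim B)
    moreover have "(\<lambda>m. e n + e m) \<longlonglongrightarrow> e n + 0"
      by (intro tendsto_intros e)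
    ultimately show ?thesis
      using Cauchy[OF B] by (auto intro: LIMSEQ_le)
  qed
  have L_nonneg: "0 \<le> L B" if "B \<in> sets N" for B
    using lim[OF that] by (rule LIMSEQ_le_const) simp
  have L_add: "L (B \<union> C) = L B + L C" if "B \<in> sets N" "C \<in> sets N" "B \<inter> C = {}" for B C
  proof -
    have "(\<lambda>n. measure (M n) (B \<union> C)) \<longlonglongrightarrow> L B + L C"
      using that by (simp add: finite_measure.finite_measure_Union[OF fin] sets_M tendsto_add lim)
    then show ?thesis
      using lim that by (intro LIMSEQ_unique[of "\<lambda>n. measure (M n) (B \<union> C)"]) auto
  qed
  have L_empty: "L {} = 0" unfolding L_def by simp
  define \<beta> where "\<beta> = measure_of (space N) (sets N) (\<lambda>B. ennreal (L B))"
  have sets_\<beta>: "sets \<beta> = sets N"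
    unfolding \<beta>_def by (simp add: sets.sigma_sets_eq sets.space_closed)
  \<comment> \<open>A finite additive set function is countably additive once it is continuous at
    the empty set. Here the uniformity of \<open>e n\<close> in the set matters: one fixed
    \<open>n\<close> controls all \<open>L (B i)\<close> up to \<open>e n\<close>, and the measure
    \<open>M n\<close> is continuous along the decreasing sequence.\<close>
  have "countably_additive (sets N) (\<lambda>B. ennreal (L B))"
  proof (rule sets.empty_continuous_imp_countably_additive)
    show "positive (sets N) (\<lambda>B. ennreal (L B))" by (simp add: positive_def L_empty)
    show "additive (sets N) (\<lambda>B. ennreal (L B))"
      by (simp add: additive_def L_add L_nonneg ennreal_plus[symmetric] del: ennreal_plus)
    show "\<forall>B\<in>sets N. ennreal (L B) \<noteq> \<infinity>" by simp
  next
    fix B :: "nat \<Rightarrow> 'a set"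
    assume B: "range B \<subseteq> sets N" "decseq B" "(\<Inter>i. B i) = {}"
    have "(\<lambda>i. L (B i)) \<longlonglongrightarrow> 0"
    proof (rule LIMSEQ_I)
      fix r :: real assume "0 < r"
      then obtain n where n: "\<bar>e n\<bar> < r / 2"
        using LIMSEQ_D[OF e, of "r / 2"] by auto
      have "(\<lambda>i. measure (M n) (B i)) \<longlonglongrightarrow> measure (M n) (\<Inter>i. B i)"
        using B sets_M by (intro finite_measure.finite_Lim_measure_decseq fin) auto
      then obtain i0 where i0: "\<And>i. i0 \<le> i \<Longrightarrow> measure (M n) (B i) < r / 2"
        using LIMSEQ_D[of _ 0 "r / 2"] \<open>0 < r\<close> B(3) by fastforce
      show "\<exists>i0. \<forall>i\<ge>i0. norm (L (B i) - 0) < r"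
      proof (intro exI[of _ i0] allI impI)
        fix i assume "i0 \<le> i"
        moreover have "B i \<in> sets N" using B by auto
        ultimately show "norm (L (B i) - 0) < r"
          using bound[of "B i" n] i0[of i] n L_nonneg[of "B i"] by simp
      qed
    qed
    then show "(\<lambda>i. ennreal (L (B i))) \<longlonglongrightarrow> 0"
      using tendsto_ennrealI by fastforce
  qed
  then have emeasure_\<beta>: "emeasure \<beta> B = ennreal (L B)" if "B \<in> sets N" for B
    using that sets_\<beta>
    by (intro emeasure_measure_of[OF \<beta>_def]) (auto simp: sets.space_closed positive_def L_empty)
  have space_\<beta>: "space \<beta> = space N" using sets_\<beta> by (rule sets_eq_imp_space_eq)
  have "L (space N) = 1" using lim[OF sets.top] mass by (rule LIMSEQ_unique)
  then have "prob_space \<beta>"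
    by (intro prob_spaceI) (simp add: space_\<beta> emeasure_\<beta>)
  moreover have "measure \<beta> B = L B" if "B \<in> sets N" for B
    using that by (simp add: measure_def emeasure_\<beta> L_nonneg)
  ultimately show ?thesis using that sets_\<beta> bound by auto
qed

text \<open>The sum counts the levels \<open>k / n\<close> below \<open>y\<close>, so it equals the
  floor of \<open>n * y\<close>. This is the layer-cake approximation of \<open>y\<close> from
  below.\<close>

lemma floor_step_bounds:
  fixes y :: real and n :: nat
  assumes "0 \<le> y" "y \<le> 1" "0 < n"
  shows "(\<Sum>k=1..n. indicator {y. real k / real n \<le> y} y) / real n \<le> y"
    "y \<le> (\<Sum>k=1..n. indicator {y. real k / real n \<le> y} y) / real n + 1 / real n"
proof -
  have "{k \<in> {1..n}. real k / real n \<le> y} = {1..nat \<lfloor>real n * y\<rfloor>}"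
  proof safe
    fix k assume "k \<in> {1..n}" "real k / real n \<le> y"
    then have "real k \<le> real n * y" using assms by (simp add: field_simps)
    then show "k \<in> {1..nat \<lfloor>real n * y\<rfloor>}" using \<open>k \<in> {1..n}\<close> by (auto simp: le_nat_floor)
  next
    fix k assume k: "k \<in> {1..nat \<lfloor>real n * y\<rfloor>}"
    moreover have "real (nat \<lfloor>real n * y\<rfloor>) \<le> real n * y" using assms by simp
    ultimately have "real k \<le> real n * y" by (auto intro: order_trans[rotated])
    moreover have "real n * y \<le> real n" using assms by (simp add: mult_left_le)
    ultimately have "real k \<le> real n" by linarith
    with k show "k \<in> {1..n}" by simp
    show "real k / real n \<le> y" using \<open>real k \<le> real n * y\<close> assms by (simp add: field_simps)
  qed
  then have "card {k \<in> {1..n}. real k / real n \<le> y} = nat \<lfloor>real n * y\<rfloor>" by simp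
  moreover have "(\<Sum>k=1..n. indicator {y. real k / real n \<le> y} y) = real (card {k \<in> {1..n}. real k / real n \<le> y})"
    by (simp add: indicator_def sum.If_cases Int_def flip: sum.inter_filter)
  ultimately have eq: "(\<Sum>k=1..n. indicator {y. real k / real n \<le> y} y) = real_of_int \<lfloor>real n * y\<rfloor>"
    using assms by simp
  have "real_of_int \<lfloor>real n * y\<rfloor> \<le> real n * y" "real n * y \<le> real_of_int \<lfloor>real n * y\<rfloor> + 1"
    by linarith+
  then show "(\<Sum>k=1..n. indicator {y. real k / real n \<le> y} y) / real n \<le> y"
    "y \<le> (\<Sum>k=1..n. indicator {y. real k / real n \<le> y} y) / real n + 1 / real n"
    using assms unfolding eq by (auto simp: field_simps)
qed

text \<open>Up to \<open>1 / n\<close>, \<open>f\<close> is the average of the indicators of its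
  level sets \<open>f x \<ge> k / n\<close>. Each of the \<open>n\<close> level sets costs at most
  \<open>e\<close>, and averaging them costs \<open>e\<close> again, not \<open>n * e\<close>; the
  discretisation error vanishes as \<open>n\<close> grows.\<close>

lemma integral_diff_le_setwise:
  fixes f :: "'a \<Rightarrow> real"
  assumes "finite_measure M" "finite_measure N" "sets M = sets N"
    and le: "\<And>B. B \<in> sets N \<Longrightarrow> \<bar>measure M B - measure N B\<bar> \<le> e"
    and f: "f \<in> borel_measurable N" "\<And>x. 0 \<le> f x" "\<And>x. f x \<le> 1"
  shows "\<bar>(\<integral>x. f x \<partial>M) - (\<integral>x. f x \<partial>N)\<bar> \<le> e"
proof -
  define B where "B n k = {x \<in> space N. real k / real n \<le> f x}" for n k :: nat
  have B: "B n k \<in> sets N" for n k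
    unfolding B_def using f(1) by measurable
  define c where "c = measure M (space N) + measure N (space N)"
  have step: "(\<Sum>k=1..n. measure Q (B n k)) / real n \<le> (\<integral>x. f x \<partial>Q) \<and>
      (\<integral>x. f x \<partial>Q) \<le> (\<Sum>k=1..n. measure Q (B n k)) / real n + measure Q (space N) / real n"
    if n: "0 < n" and Q: "finite_measure Q" "sets Q = sets N" for n Q
  proof -
    interpret Q: finite_measure Q by fact
    have spQ: "space Q = space N" using Q(2) by (rule sets_eq_imp_space_eq)
    have fQ: "integrable Q f"
      using f Q(2) by (intro Q.integrable_const_bound[where B = 1]) (auto cong: measurable_cong_sets)
    have ind: "integrable Q (indicat_real (B n k))" for k
      using B Q(2) by (auto simp: integrable_indicator_iff less_top[symmetric])
    let ?g = "\<lambda>x. (\<Sum>k=1..n. indicat_real (B n k) x) / real n"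
    have g: "integrable Q ?g" using ind by auto
    have g_int: "(\<integral>x. ?g x \<partial>Q) = (\<Sum>k=1..n. measure Q (B n k)) / real n"
      using ind sets.sets_into_space[OF B]
      by (simp add: Bochner_Integration.integral_sum spQ Int_absorb2)
    have eq: "(\<Sum>k=1..n. indicat_real (B n k) x) = (\<Sum>k=1..n. indicator {y. real k / real n \<le> y} (f x))"
      if "x \<in> space Q" for x
      using that by (intro sum.cong refl) (auto simp: B_def spQ indicator_def)
    have "(\<integral>x. ?g x \<partial>Q) \<le> (\<integral>x. f x \<partial>Q)"
      by (rule integral_mono[OF g fQ]) (use floor_step_bounds(1)[OF f(2,3) n] eq in auto)
    moreover have "(\<integral>x. f x \<partial>Q) \<le> (\<integral>x. ?g x + 1 / real n \<partial>Q)"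
      by (rule integral_mono[OF fQ]) (use floor_step_bounds(2)[OF f(2,3) n] eq g in auto)
    moreover have "(\<integral>x. ?g x + 1 / real n \<partial>Q) = (\<integral>x. ?g x \<partial>Q) + measure Q (space N) / real n"
      using g by (subst Bochner_Integration.integral_add) (auto simp: spQ)
    ultimately show ?thesis unfolding g_int by linarith
  qed
  have "\<bar>(\<integral>x. f x \<partial>M) - (\<integral>x. f x \<partial>N)\<bar> \<le> e + c / real n" if n: "0 < n" for n
  proof -
    have "\<bar>(\<Sum>k=1..n. measure M (B n k)) - (\<Sum>k=1..n. measure N (B n k))\<bar> \<le> (\<Sum>k=1..n. e)"
      unfolding sum_subtractf[symmetric] by (rule order_trans[OF sum_abs sum_mono]) (use le B in auto)
    then have "\<bar>(\<Sum>k=1..n. measure M (B n k)) - (\<Sum>k=1..n. measure N (B n k))\<bar> / real n \<le> (real n * e) / real n"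
      by (intro divide_right_mono) simp_all
    then have "\<bar>(\<Sum>k=1..n. measure M (B n k)) / real n - (\<Sum>k=1..n. measure N (B n k)) / real n\<bar> \<le> e"
      using n by (simp add: diff_divide_distrib[symmetric] abs_divide)
    moreover have "0 \<le> measure M (space N) / real n" "0 \<le> measure N (space N) / real n" by simp_all
    moreover have "c / real n = measure M (space N) / real n + measure N (space N) / real n"
      by (simp add: c_def add_divide_distrib)
    ultimately show ?thesis
      using step[OF n assms(1,3)] step[OF n assms(2) refl] by linarith
  qed
  moreover have "(\<lambda>n. e + c / real n) \<longlonglongrightarrow> e + 0"
    by (intro tendsto_add tendsto_const lim_const_over_n)
  ultimately show ?thesis
    using LIMSEQ_le_const[of "\<lambda>n. e + c / real n" e] by (metis add_0_right gr0I less_le_trans not_one_le_zero zero_less_one)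
qed

text \<open>An affine map carries \<open>f\<close> into the unit interval. With
  \<open>a = b + 1\<close>, which is positive even for \<open>b = 0\<close>, undoing the map costs
  \<open>2 * a * e\<close> for the integral and another \<open>a * e\<close> because the two total
  masses may differ.\<close>

lemma integral_diff_le_setwise_bounded:
  fixes f :: "'a \<Rightarrow> real"
  assumes "finite_measure M" "finite_measure N" "sets M = sets N"
    and le: "\<And>B. B \<in> sets N \<Longrightarrow> \<bar>measure M B - measure N B\<bar> \<le> e"
    and f: "f \<in> borel_measurable N" "\<And>x. \<bar>f x\<bar> \<le> b"
  shows "\<bar>(\<integral>x. f x \<partial>M) - (\<integral>x. f x \<partial>N)\<bar> \<le> 3 * (b + 1) * e"
proof -
  interpret M: finite_measure M by fact
  interpret N: finite_measure N by fact
  have "0 \<le> b" using abs_ge_zero f(2) by (rule order_trans)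
  define a where "a = b + 1"
  have a: "0 < a" "\<bar>f x\<bar> \<le> a" for x using \<open>0 \<le> b\<close> f(2)[of x] by (auto simp: a_def)
  define g where "g x = (f x + a) / (2 * a)" for x
  have g: "g \<in> borel_measurable N" "0 \<le> g x" "g x \<le> 1" for x
    unfolding g_def[abs_def] using f(1) a(1) a(2)[of x] by (auto simp: field_simps)
  have intM: "integrable M g" and intN: "integrable N g"
    using g assms(3)
    by (auto intro!: M.integrable_const_bound[where B = 1] N.integrable_const_bound[where B = 1]
        cong: measurable_cong_sets)
  have space: "space M = space N" using assms(3) by (rule sets_eq_imp_space_eq)
  have f_eq: "f = (\<lambda>x. 2 * a * g x - a)" using a(1) by (auto simp: g_def fun_eq_iff)
  have "(\<integral>x. f x \<partial>M) - (\<integral>x. f x \<partial>N)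
      = 2 * a * ((\<integral>x. g x \<partial>M) - (\<integral>x. g x \<partial>N)) - a * (measure M (space N) - measure N (space N))"
    unfolding f_eq using intM intN
    by (simp add: Bochner_Integration.integral_diff space algebra_simps)
  then have "\<bar>(\<integral>x. f x \<partial>M) - (\<integral>x. f x \<partial>N)\<bar>
      \<le> 2 * a * \<bar>(\<integral>x. g x \<partial>M) - (\<integral>x. g x \<partial>N)\<bar> + a * \<bar>measure M (space N) - measure N (space N)\<bar>"
    using a(1) abs_triangle_ineq4 by (metis (no_types, lifting) abs_mult abs_numeral abs_of_pos)
  also have "\<dots> \<le> 2 * a * e + a * e"
    using a(1) integral_diff_le_setwise[OF assms(1-3) le g] le
    by (intro add_mono mult_left_mono) auto
  finally show ?thesis by (simp add: a_def algebra_simps)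
qed

text \<open>The indicator of a nonempty closed set is the pointwise limit of bounded continuous
  functions of the distance to it, so the measures agree on closed sets, which form an
  intersection-stable generator.\<close>

lemma borel_measure_eqI_continuous:
  fixes M N :: "'a::metric_space measure"
  assumes M: "prob_space M" "sets M = sets borel" and N: "prob_space N" "sets N = sets borel"
    and eq: "\<And>f :: 'a \<Rightarrow> real. continuous_on UNIV f \<Longrightarrow> bounded (range f) \<Longrightarrow>
      (\<integral>x. f x \<partial>M) = (\<integral>x. f x \<partial>N)"
  shows "M = N"
proof -
  interpret M: prob_space M by fact
  interpret N: prob_space N by fact
  have closed_eq: "emeasure M C = emeasure N C" if C: "closed C" for C :: "'a set"
  \<comment> \<open>The empty set is treated apart because \<open>infdist x {}\<close> is 0 by
    convention, so the approximating functions would tend to 1.\<close>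
  proof (cases "C = {}")
    case False
    define f where "f n x = max 0 (1 - real n * infdist x C)" for n :: nat and x
    have f: "continuous_on UNIV (f n)" "0 \<le> f n x" "f n x \<le> 1" for n x
      unfolding f_def[abs_def] by (auto intro!: continuous_intros simp: infdist_nonneg)
    have "bounded (range (f n))" for n
      by (rule boundedI[of _ 1]) (use f(2,3) in auto)
    then have int_eq: "(\<integral>x. f n x \<partial>M) = (\<integral>x. f n x \<partial>N)" for n
      using eq f(1) by blast
    have lim: "(\<lambda>n. f n x) \<longlonglongrightarrow> indicator C x" for x
    proof (cases "x \<in> C")
      case True
      then show ?thesis by (simp add: f_def)
    next
      case F: False
      then have pos: "0 < infdist x C"
        using C False by (metis in_closed_iff_infdist_zero infdist_nonneg less_eq_real_def)
      have "eventually (\<lambda>n. f n x = indicator C x) sequentially"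
        using eventually_ge_at_top[of "nat \<lceil>1 / infdist x C\<rceil>"]
      proof eventually_elim
        case (elim n)
        then have "1 / infdist x C \<le> real n" by linarith
        then show ?case using pos F by (simp add: f_def field_simps)
      qed
      then show ?thesis by (rule tendsto_eventually)
    qed
    have conv: "(\<lambda>n. \<integral>x. f n x \<partial>Q) \<longlonglongrightarrow> measure Q C"
      if Q: "prob_space Q" "sets Q = sets borel" for Q :: "'a measure"
    proof -
      interpret Q: prob_space Q by fact
      have "(\<lambda>n. \<integral>x. f n x \<partial>Q) \<longlonglongrightarrow> (\<integral>x. indicator C x \<partial>Q)"
      proof (rule integral_dominated_convergence[where w = "\<lambda>_. 1"])
        show "f n \<in> borel_measurable Q" for n
          using borel_measurable_continuous_onI[OF f(1)] Q(2) by (simp cong: measurable_cong_sets)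
        show "indicat_real C \<in> borel_measurable Q"
          using C Q(2) by (simp cong: measurable_cong_sets)
      qed (use lim f in auto)
      then show ?thesis
        using sets_eq_imp_space_eq[OF Q(2)] by simp
    qed
    have "measure M C = measure N C"
      using conv[OF M] conv[OF N] int_eq by (auto intro: LIMSEQ_unique)
    then show ?thesis by (simp add: M.emeasure_eq_measure N.emeasure_eq_measure)
  qed simp
  show ?thesis
  proof (rule measure_eqI_generator_eq[where E = "Collect closed" and \<Omega> = UNIV and A = "\<lambda>_. UNIV"])
    show "Int_stable (Collect closed :: 'a set set)" by (auto simp: Int_stable_def)
    show "sets M = sigma_sets UNIV (Collect closed)" "sets N = sigma_sets UNIV (Collect closed)"
      using M(2) N(2) by (simp_all add: borel_eq_closed)
  qed (use closed_eq in \<open>auto\<close>)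
qed

text \<open>Converts a contraction per step of length \<open>t0\<close> into exponential decay in
  time. The exponent is one below the number of complete steps because comparing two horizons spends
  one step before any contraction.\<close>

lemma geometric_le_exp:
  fixes a t0 :: real
  assumes "0 \<le> a" "a < 1" "0 < t0"
  obtains \<kappa> C where "0 < \<kappa>" "0 < C"
    "\<And>x. 0 \<le> x \<Longrightarrow> a ^ (nat \<lfloor>x / t0\<rfloor> - 1) \<le> C * exp (- \<kappa> * x)"
proof -
  \<comment> \<open>The rate \<open>a\<close> may be 0, namely if \<open>c1 * c2 = 1\<close>; a
    positive base is needed for its logarithm. The factor \<open>1 / b ^ 2\<close> pays for rounding
    down and for the subtracted step.\<close>
  define b where "b = max a (1 / 2)"
  have b: "0 < b" "b < 1" "a \<le> b" using assms by (auto simp: b_def)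
  show ?thesis
  proof (rule that[of "- ln b / t0" "1 / b ^ 2"])
    fix x :: real assume x: "0 \<le> x"
    let ?n = "nat \<lfloor>x / t0\<rfloor> - 1"
    have "x / t0 - 2 \<le> real ?n" using x assms by linarith
    have "a ^ ?n \<le> b ^ ?n" using b assms by (intro power_mono) auto
    also have "\<dots> = b powr real ?n" using b by (simp add: powr_realpow)
    also have "\<dots> \<le> b powr (x / t0 - 2)" using b \<open>x / t0 - 2 \<le> real ?n\<close> by (intro powr_mono') auto
    also have "\<dots> = b powr (x / t0) / b ^ 2" using b by (simp add: powr_diff)
    also have "\<dots> = 1 / b ^ 2 * exp (- (- ln b / t0) * x)" using b by (simp add: powr_def mult.commute)
    finally show "a ^ ?n \<le> 1 / b ^ 2 * exp (- (- ln b / t0) * x)" .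
  qed (use b assms in \<open>auto simp: field_simps\<close>)
qed

section \<open>Time averages\<close>

text \<open>A common notation for both time sets. The discrete sum includes both endpoints, as in
  \<open>time_average\<close>; the continuous case uses the gauge integral, which is convenient for
  splitting intervals and is identified with the Lebesgue integral later.\<close>

definition time_sum :: "real set \<Rightarrow> real \<Rightarrow> (real \<Rightarrow> real) \<Rightarrow> real" where
  "time_sum I T f = (if I = \<nat> then \<Sum>k | k \<in> \<nat> \<and> k \<le> T. f k else integral {0..T} f)"

definition time_summable :: "real set \<Rightarrow> real \<Rightarrow> (real \<Rightarrow> real) \<Rightarrow> bool" where
  "time_summable I T f \<longleftrightarrow> I = \<nat> \<or> f integrable_on {0..T}"

lemma atLeast_neq_Nats: "{0::real..} \<noteq> \<nat>"
proof
  assume "{0::real..} = \<nat>"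
  moreover have "(1/2::real) \<in> {0..}" by simp
  ultimately have "(1/2::real) \<in> \<nat>" by metis
  then obtain n where "1/2 = real n" by (auto elim: Nats_cases)
  then have "1 = 2 * n" by linarith
  then show False by presburger
qed

lemma time_sum_Nats: "time_sum \<nat> (real n) f = (\<Sum>k\<le>n. f (real k))"
proof -
  have "{k \<in> \<nat>. k \<le> real n} = real ` {..n}"
    by (auto elim!: Nats_cases)
  then show ?thesis
    by (simp add: time_sum_def sum.reindex flip: Collect_conj_eq)
qed

lemma time_sum_atLeast: "time_sum {0..} T f = integral {0..T} f"
  using atLeast_neq_Nats by (simp add: time_sum_def)

lemma time_summable_atLeast: "time_summable {0..} T f \<longleftrightarrow> f integrable_on {0..T}"
  using atLeast_neq_Nats by (simp add: time_summable_def)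

locale time_line =
  fixes I :: "real set"
  assumes time_set: "I = {0..} \<or> I = \<nat>"
begin

lemma time_cases:
  assumes "T \<in> I"
  obtains "I = {0..}" "0 \<le> T" | n where "I = \<nat>" "T = real n"
  using assms time_set by (auto elim!: Nats_cases)

text \<open>In discrete time the instant \<open>S\<close> belongs to both pieces, hence the
  subtracted term; in continuous time a single instant has no mass.\<close>

lemma time_sum_split:
  assumes "S \<in> I" "T \<in> I" "time_summable I (S + T) f"
  shows "time_summable I S f" "time_summable I T (\<lambda>s. f (S + s))"
    "time_sum I (S + T) f = time_sum I S f + time_sum I T (\<lambda>s. f (S + s)) - (if I = \<nat> then f S else 0)"
proof -
  have "time_summable I S f \<and> time_summable I T (\<lambda>s. f (S + s)) \<and>
    time_sum I (S + T) f = time_sum I S f + time_sum I T (\<lambda>s. f (S + s)) - (if I = \<nat> then f S else 0)"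
    using assms(1)
  proof (cases rule: time_cases)
    case 1
    with assms have ST: "0 \<le> S" "0 \<le> T" and f: "f integrable_on {0..S+T}"
      by (auto simp: time_summable_atLeast)
    have f1: "f integrable_on {0..S}" and f2: "f integrable_on {S..S+T}"
      using ST by (auto intro: integrable_subinterval_real[OF f])
    have "((\<lambda>x. f (1 *\<^sub>R x + S)) has_integral (integral {S..S+T} f /\<^sub>R 1 ^ DIM(real)))
        (cbox ((S - S) /\<^sub>R 1) ((S + T - S) /\<^sub>R 1))"
      by (rule has_integral_affinity') (use f2 in auto)
    then have shift: "((\<lambda>x. f (S + x)) has_integral integral {S..S+T} f) {0..T}"
      by (simp add: add.commute)
    have "integral {0..S} f + integral {S..S+T} f = integral {0..S+T} f"
      by (rule Henstock_Kurzweil_Integration.integral_combine) (use ST f in auto)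
    with shift f1 show ?thesis
      using 1 atLeast_neq_Nats
      by (auto simp: time_summable_atLeast time_sum_atLeast dest: integral_unique)
  next
    case (2 m)
    then obtain n where n: "T = real n" using assms by (auto elim: Nats_cases)
    have "(\<Sum>k\<le>m+n. f (real k)) = (\<Sum>k\<le>m. f (real k)) + (\<Sum>k\<le>n. f (real (m + k))) - f (real m)"
    proof (induction n)
      case (Suc n) then show ?case by (simp add: ac_simps)
    qed simp
    then show ?thesis
      using time_sum_Nats[of "m + n"] by (simp add: 2 n time_sum_Nats time_summable_def)
  qed
  then show "time_summable I S f" "time_summable I T (\<lambda>s. f (S + s))"
    "time_sum I (S + T) f = time_sum I S f + time_sum I T (\<lambda>s. f (S + s)) - (if I = \<nat> then f S else 0)"
    by auto
qed

lemma time_sum_diff_le: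
  assumes "T \<in> I" "time_summable I T f" "time_summable I T g" "time_summable I T \<rho>"
    and le: "\<And>s. s \<in> I \<Longrightarrow> s \<le> T \<Longrightarrow> \<bar>f s - g s\<bar> \<le> \<rho> s"
  shows "\<bar>time_sum I T f - time_sum I T g\<bar> \<le> time_sum I T \<rho>"
  using assms(1)
proof (cases rule: time_cases)
  case 1
  then have int: "f integrable_on {0..T}" "g integrable_on {0..T}" "\<rho> integrable_on {0..T}"
    using assms by (auto simp: time_summable_atLeast)
  have "norm (integral {0..T} (\<lambda>s. f s - g s)) \<le> integral {0..T} \<rho>"
    by (rule Henstock_Kurzweil_Integration.integral_norm_bound_integral)
       (use int le 1 in \<open>auto intro: Henstock_Kurzweil_Integration.integrable_diff\<close>)
  then show ?thesis
    using int 1 by (simp add: time_sum_atLeast Henstock_Kurzweil_Integration.integral_diff)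
next
  case (2 n)
  have "\<bar>\<Sum>k\<le>n. f (real k) - g (real k)\<bar> \<le> (\<Sum>k\<le>n. \<rho> (real k))"
    by (rule order_trans[OF sum_abs sum_mono]) (use le 2 in auto)
  then show ?thesis by (simp add: 2 time_sum_Nats sum_subtractf)
qed

lemma time_sum_one:
  assumes "T \<in> I"
  shows "time_sum I T (\<lambda>_. 1) = (if I = \<nat> then T + 1 else T)"
  using assms
proof (cases rule: time_cases)
  case 1
  then show ?thesis using atLeast_neq_Nats by (simp add: time_sum_atLeast)
next
  case (2 n)
  then show ?thesis by (simp add: time_sum_Nats)
qed

lemma time_summable_continuous:
  "continuous_on UNIV f \<Longrightarrow> time_summable I T f"
  unfolding time_summable_def
  by (auto intro: integrable_continuous_real continuous_on_subset)

lemma time_sum_abs_le: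
  assumes "T \<in> I" "time_summable I T f" "\<And>s. s \<in> I \<Longrightarrow> s \<le> T \<Longrightarrow> \<bar>f s\<bar> \<le> 1"
  shows "\<bar>time_sum I T f\<bar> \<le> T + 1"
proof -
  have "\<bar>time_sum I T f - time_sum I T (\<lambda>_. 0)\<bar> \<le> time_sum I T (\<lambda>_. 1)"
    by (rule time_sum_diff_le) (use assms in \<open>auto intro: time_summable_continuous\<close>)
  moreover have "time_sum I T (\<lambda>_. 0) = 0" by (simp add: time_sum_def)
  moreover have "time_sum I T (\<lambda>_. 1) \<le> T + 1" by (simp add: time_sum_one assms)
  ultimately show ?thesis by linarith
qed

text \<open>The bounds are the full integral \<open>1 / \<kappa>\<close> and the full geometric
  series with ratio \<open>exp (- \<kappa>)\<close>; the second sum is the first with time reversed.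
  What matters is that \<open>K\<close> does not depend on \<open>T\<close>.\<close>

lemma time_sum_exp:
  assumes "\<kappa> > 0"
  obtains K where "K \<ge> 0"
    "\<And>T. T \<in> I \<Longrightarrow> time_sum I T (\<lambda>s. exp (- \<kappa> * s)) \<le> K"
    "\<And>T. T \<in> I \<Longrightarrow> time_sum I T (\<lambda>s. exp (- \<kappa> * (T - s))) \<le> K"
proof -
  define q where "q = exp (- \<kappa>)"
  have q: "0 < q" "q < 1" using assms by (auto simp: q_def)
  define K where "K = max (1 / \<kappa>) (1 / (1 - q))"
  have geometric: "(\<Sum>k\<le>n. q ^ k) \<le> K" for n
  proof -
    have "(\<Sum>k\<le>n. q ^ k) \<le> (\<Sum>k. q ^ k)"
      using q by (intro sum_le_suminf) auto
    also have "\<dots> = 1 / (1 - q)" using q by (intro suminf_geometric) simp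
    finally show ?thesis by (simp add: K_def)
  qed
  have exp_q: "exp (- \<kappa> * real k) = q ^ k" for k
    by (simp add: q_def mult.commute flip: exp_of_nat_mult)
  show ?thesis
  proof
    show "0 \<le> K" using assms by (simp add: K_def le_max_iff_disj)
  next
    fix T assume "T \<in> I"
    then show "time_sum I T (\<lambda>s. exp (- \<kappa> * s)) \<le> K"
    proof (cases rule: time_cases)
      case 1
      have "((\<lambda>s. exp (- \<kappa> * s)) has_integral (- exp (- \<kappa> * T) / \<kappa> - - exp (- \<kappa> * 0) / \<kappa>)) {0..T}"
        using assms 1
        by (intro fundamental_theorem_of_calculus)
           (auto intro!: derivative_eq_intros simp flip: has_real_derivative_iff_has_vector_derivative)
      then show ?thesis
        using 1 assms
        by (simp add: time_sum_atLeast integral_unique K_def le_max_iff_disj divide_right_mono flip: diff_divide_distrib)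
    next
      case (2 n)
      show ?thesis unfolding 2 time_sum_Nats exp_q by (rule geometric)
    qed
  next
    fix T assume "T \<in> I"
    then show "time_sum I T (\<lambda>s. exp (- \<kappa> * (T - s))) \<le> K"
    proof (cases rule: time_cases)
      case 1
      have "((\<lambda>s. exp (- \<kappa> * (T - s))) has_integral (exp (- \<kappa> * (T - T)) / \<kappa> - exp (- \<kappa> * (T - 0)) / \<kappa>)) {0..T}"
        using assms 1
        by (intro fundamental_theorem_of_calculus)
           (auto intro!: derivative_eq_intros simp flip: has_real_derivative_iff_has_vector_derivative)
      then show ?thesis
        using 1 assms
        by (simp add: time_sum_atLeast integral_unique K_def le_max_iff_disj divide_right_mono flip: diff_divide_distrib)
    next
      case (2 n)
      have "(\<Sum>k\<le>n. exp (- \<kappa> * (real n - real k))) = (\<Sum>k\<le>n. q ^ (n - k))"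
        by (intro sum.cong refl) (simp add: exp_q[symmetric] of_nat_diff)
      also have "\<dots> = (\<Sum>k\<le>n. q ^ k)"
        by (rule sum.reindex_bij_witness[of _ "\<lambda>k. n - k" "\<lambda>k. n - k"]) auto
      finally show ?thesis using geometric by (simp add: 2 time_sum_Nats del: mult_minus_left)
    qed
  qed
qed

end

section \<open>Quasi-additive sequences and the Cauchy property of averages\<close>

lemma quasi_additive_multiple:
  fixes a :: "nat \<Rightarrow> real"
  assumes "\<And>m n. \<bar>a (m + n) - a m - a n\<bar> \<le> K"
  shows "\<bar>a (Suc m * n) - real (Suc m) * a n\<bar> \<le> real m * K"
proof (induction m)
  case (Suc m)
  have "\<bar>a (Suc m * n + n) - a (Suc m * n) - a n\<bar> \<le> K" by (rule assms)
  then have "\<bar>a (Suc (Suc m) * n) - a (Suc m * n) - a n\<bar> \<le> K"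
    by (simp add: add.commute)
  with Suc show ?case by (simp add: algebra_simps)
qed simp

text \<open>Both averages are compared with the average at the common multiple \<open>m * n\<close>,
  which consists of \<open>m\<close> blocks of length \<open>n\<close> and also of \<open>n\<close>
  blocks of length \<open>m\<close>.\<close>

lemma quasi_additive_average:
  fixes a :: "nat \<Rightarrow> real"
  assumes "\<And>m n. \<bar>a (m + n) - a m - a n\<bar> \<le> K" "0 < m" "0 < n"
  shows "\<bar>a m / real m - a n / real n\<bar> \<le> K / real m + K / real n"
proof -
  have "0 \<le> K" using assms(1)[of 0 0] by linarith
  have *: "\<bar>a (m * n) / real (m * n) - a n / real n\<bar> \<le> K / real n" if "0 < m" "0 < n" for m n
  proof -
    obtain k where k: "m = Suc k" using \<open>0 < m\<close> gr0_implies_Suc by blast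
    have "\<bar>a (m * n) - real m * a n\<bar> \<le> real k * K"
      using quasi_additive_multiple[OF assms(1), of k n] by (simp add: k)
    also have "\<dots> \<le> real m * K" using \<open>0 \<le> K\<close> by (simp add: k mult_right_mono)
    finally have "\<bar>a (m * n) - real m * a n\<bar> / real (m * n) \<le> real m * K / real (m * n)"
      by (rule divide_right_mono) simp
    moreover have "a (m * n) / real (m * n) - a n / real n = (a (m * n) - real m * a n) / real (m * n)"
      using that by (simp add: field_simps)
    ultimately show ?thesis using that by (simp add: abs_divide)
  qed
  have "\<bar>a (m * n) / real (m * n) - a m / real m\<bar> \<le> K / real m"
    using *[OF assms(3,2)] by (simp add: mult.commute)
  with *[OF assms(2,3)] show ?thesis by linarith
qed

context time_line
begin

text \<open>\<open>F s T\<close> stands for the probability of an event at time \<open>s\<close>, given survival up to \<open>T\<close>: it forgets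
  the horizon \<open>T\<close> and the initial time exponentially fast.\<close>

definition exponentially_forgetful :: "real \<Rightarrow> real \<Rightarrow> real \<Rightarrow> (real \<Rightarrow> real \<Rightarrow> real) \<Rightarrow> bool" where
  "exponentially_forgetful \<gamma> C \<kappa> F \<longleftrightarrow>
    (\<forall>T\<in>I. time_summable I T (\<lambda>s. F s T)) \<and>
    (\<forall>s\<in>I. \<forall>T\<in>I. s \<le> T \<longrightarrow> \<bar>F s T\<bar> \<le> 1) \<and>
    (\<forall>s\<in>I. \<forall>T\<in>I. \<forall>T'\<in>I. s \<le> T \<longrightarrow> T \<le> T' \<longrightarrow> \<bar>F s T' - F s T\<bar> \<le> C * exp (- \<kappa> * (T - s))) \<and>
    (\<forall>s\<in>I. \<forall>T\<in>I. \<forall>k. s \<le> T \<longrightarrow>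
      \<bar>F (s + real k * \<gamma>) (T + real k * \<gamma>) - F s T\<bar> \<le> C * exp (- \<kappa> * s))"

text \<open>The integral up to time \<open>n * \<gamma>\<close> is quasi-additive in \<open>n\<close>: in the integral up to \<open>(m + n) * \<gamma>\<close>, the
  part before \<open>m * \<gamma>\<close> forgets the horizon, and the part after \<open>m * \<gamma>\<close> forgets the starting time.\<close>

lemma time_average_Cauchy:
  assumes "\<kappa> > 0" "C \<ge> 0" "\<gamma> \<in> I" "\<gamma> > 0"
  obtains K where "K \<ge> 0" "\<And>F S T. \<lbrakk>exponentially_forgetful \<gamma> C \<kappa> F; S \<in> I; T \<in> I; \<gamma> \<le> S; \<gamma> \<le> T\<rbrakk>
    \<Longrightarrow> \<bar>time_sum I S (\<lambda>s. F s S) / S - time_sum I T (\<lambda>s. F s T) / T\<bar> \<le> K / S + K / T"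
proof -
  obtain K0 where K0: "K0 \<ge> 0"
      "\<And>T. T \<in> I \<Longrightarrow> time_sum I T (\<lambda>s. exp (- \<kappa> * s)) \<le> K0"
      "\<And>T. T \<in> I \<Longrightarrow> time_sum I T (\<lambda>s. exp (- \<kappa> * (T - s))) \<le> K0"
    using time_sum_exp[OF assms(1)] by blast
  have mult: "time_sum I T (\<lambda>s. C * f s) = C * time_sum I T f" for T f
    by (simp add: time_sum_def sum_distrib_left)
  \<comment> \<open>\<open>K1\<close> bounds the effect of dropping an incomplete period: the
    changed horizon costs \<open>C * K0\<close>, the remainder less than
    \<open>\<gamma> + 1\<close>, the shared endpoint 1. \<open>K2\<close> is the quasi-additivity
    defect: one term for forgetting the horizon, one for forgetting the start, and 1 for the
    endpoint. All constants are fixed before \<open>F\<close>, so the estimate is uniform over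
    events and initial laws.\<close>
  define K1 where "K1 = C * K0 + \<gamma> + 2"
  define K2 where "K2 = 2 * (C * K0) + 1"
  define K where "K = K1 + \<gamma> + 1 + 2 * K2"
  have nonneg: "0 \<le> C * K0" "0 \<le> K1" "0 \<le> K2" "0 \<le> K"
    using assms K0 by (auto simp: K_def K1_def K2_def)
  have I_add: "s + t \<in> I" if "s \<in> I" "t \<in> I" for s t
    using that time_set by auto
  have I_mult: "real n * \<gamma> \<in> I" for n
    using assms(3) time_set by auto
  show thesis
  proof (rule that[OF nonneg(4)])
    fix F :: "real \<Rightarrow> real \<Rightarrow> real" and S0 T0 :: real
    assume "exponentially_forgetful \<gamma> C \<kappa> F" and ST0: "S0 \<in> I" "T0 \<in> I" "\<gamma> \<le> S0" "\<gamma> \<le> T0"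
    then have summ: "\<And>T. T \<in> I \<Longrightarrow> time_summable I T (\<lambda>s. F s T)"
      and bnd: "\<And>s T. s \<in> I \<Longrightarrow> T \<in> I \<Longrightarrow> s \<le> T \<Longrightarrow> \<bar>F s T\<bar> \<le> 1"
      and horizon: "\<And>s T T'. s \<in> I \<Longrightarrow> T \<in> I \<Longrightarrow> T' \<in> I \<Longrightarrow> s \<le> T \<Longrightarrow> T \<le> T' \<Longrightarrow>
        \<bar>F s T' - F s T\<bar> \<le> C * exp (- \<kappa> * (T - s))"
      and shift: "\<And>s T (k::nat). s \<in> I \<Longrightarrow> T \<in> I \<Longrightarrow> s \<le> T \<Longrightarrow>
        \<bar>F (s + real k * \<gamma>) (T + real k * \<gamma>) - F s T\<bar> \<le> C * exp (- \<kappa> * s)"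
      unfolding exponentially_forgetful_def by blast+
    define \<Phi> where "\<Phi> T = time_sum I T (\<lambda>s. F s T)" for T
    have cont_exp: "time_summable I T (\<lambda>s. C * exp (- \<kappa> * s))" "time_summable I T (\<lambda>s. C * exp (- \<kappa> * (T - s)))" for T
      by (intro time_summable_continuous continuous_intros)+
    have split: "\<exists>e. \<bar>e\<bar> \<le> 1 \<and> \<Phi> (S + T) = time_sum I S (\<lambda>s. F s (S + T)) + time_sum I T (\<lambda>s. F (S + s) (S + T)) + e"
      and summ1: "time_summable I S (\<lambda>s. F s (S + T))"
      and summ2: "time_summable I T (\<lambda>s. F (S + s) (S + T))"
      and first: "\<bar>time_sum I S (\<lambda>s. F s (S + T)) - \<Phi> S\<bar> \<le> C * K0"
      if ST: "S \<in> I" "T \<in> I" for S T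
    proof -
      have T: "0 \<le> T" using ST time_set by (auto simp: Nats_def)
      note sp = time_sum_split[OF ST summ[OF I_add[OF ST]]]
      show "time_summable I S (\<lambda>s. F s (S + T))" "time_summable I T (\<lambda>s. F (S + s) (S + T))"
        by (rule sp)+
      show "\<exists>e. \<bar>e\<bar> \<le> 1 \<and> \<Phi> (S + T) = time_sum I S (\<lambda>s. F s (S + T)) + time_sum I T (\<lambda>s. F (S + s) (S + T)) + e"
        using bnd[OF ST(1) I_add[OF ST]] T sp(3)
        by (intro exI[of _ "- (if I = \<nat> then F S (S + T) else 0)"]) (simp add: \<Phi>_def)
      have "\<bar>time_sum I S (\<lambda>s. F s (S + T)) - \<Phi> S\<bar> \<le> time_sum I S (\<lambda>s. C * exp (- \<kappa> * (S - s)))"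
        unfolding \<Phi>_def using ST I_add T
        by (intro time_sum_diff_le sp summ cont_exp horizon) auto
      also have "\<dots> \<le> C * K0" unfolding mult by (intro mult_left_mono K0 ST assms)
      finally show "\<bar>time_sum I S (\<lambda>s. F s (S + T)) - \<Phi> S\<bar> \<le> C * K0" .
    qed
    define a where "a n = \<Phi> (real n * \<gamma>)" for n :: nat
    have quasi: "\<bar>a (m + n) - a m - a n\<bar> \<le> K2" for m n
    proof -
      let ?S = "real m * \<gamma>" and ?T = "real n * \<gamma>"
      have "\<bar>time_sum I ?T (\<lambda>s. F (?S + s) (?S + ?T)) - \<Phi> ?T\<bar> \<le> time_sum I ?T (\<lambda>s. C * exp (- \<kappa> * s))"
        unfolding \<Phi>_def
        by (rule time_sum_diff_le[OF I_mult summ2[OF I_mult I_mult] summ[OF I_mult] cont_exp(1)])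
           (use shift[OF _ I_mult, of _ n m] in \<open>simp add: add.commute\<close>)
      also have "\<dots> \<le> C * K0" unfolding mult by (intro mult_left_mono K0 I_mult assms)
      finally have second: "\<bar>time_sum I ?T (\<lambda>s. F (?S + s) (?S + ?T)) - \<Phi> ?T\<bar> \<le> C * K0" .
      obtain e where "\<bar>e\<bar> \<le> 1" "\<Phi> (?S + ?T) = time_sum I ?S (\<lambda>s. F s (?S + ?T)) + time_sum I ?T (\<lambda>s. F (?S + s) (?S + ?T)) + e"
        using split[OF I_mult I_mult] by blast
      with first[OF I_mult I_mult, of m n] second
      have "\<bar>\<Phi> (?S + ?T) - \<Phi> ?S - \<Phi> ?T\<bar> \<le> K2" unfolding K2_def by linarith
      then show ?thesis by (simp add: a_def distrib_right)
    qed
    \<comment> \<open>\<open>T\<close> is rounded down to \<open>n\<close> complete periods. As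
      \<open>\<gamma> \<le> T\<close>, there is at least one, so \<open>T\<close> is at most twice
      the rounded time; this is where the factor 2 in front of \<open>K2\<close> in \<open>K\<close>
      comes from.\<close>
    have approx: "\<exists>n>0. T \<le> 2 * (\<gamma> * real n) \<and> \<bar>\<Phi> T / T - a n / real n / \<gamma>\<bar> \<le> (K1 + \<gamma> + 1) / T"
      if T: "T \<in> I" "\<gamma> \<le> T" for T
    proof -
      define n where "n = nat \<lfloor>T / \<gamma>\<rfloor>"
      have fl: "1 \<le> \<lfloor>T / \<gamma>\<rfloor>" using T assms by (simp add: le_floor_iff)
      then have n: "0 < n" "real n = of_int \<lfloor>T / \<gamma>\<rfloor>" by (auto simp: n_def)
      let ?S = "real n * \<gamma>"
      have "real n \<le> T / \<gamma>" "T / \<gamma> < real n + 1" unfolding n(2) by linarith+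
      then have nT: "?S \<le> T" "T < ?S + \<gamma>" using assms by (auto simp: field_simps)
      have "\<gamma> \<le> ?S" using n(1) assms(4) mult_right_mono[of 1 "real n" \<gamma>] by simp
      define d where "d = T - ?S"
      have d: "d \<in> I" "0 \<le> d" "d < \<gamma>" "T = ?S + d"
      proof -
        show "d \<in> I"
          using T(1)
        proof (cases rule: time_cases)
          case (2 k)
          with I_mult[of n] obtain l where l: "?S = real l" by (auto elim: Nats_cases)
          with nT 2 have "l \<le> k" by simp
          then have "d = real (k - l)" using l 2 by (simp add: d_def of_nat_diff)
          then show ?thesis using 2 by simp
        qed (use nT in \<open>auto simp: d_def\<close>)
      qed (use nT in \<open>auto simp: d_def\<close>)
      obtain e where e: "\<bar>e\<bar> \<le> 1" "\<Phi> (?S + d) = time_sum I ?S (\<lambda>s. F s (?S + d)) + time_sum I d (\<lambda>s. F (?S + s) (?S + d)) + e"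
        using split[OF I_mult d(1)] by blast
      have "\<bar>time_sum I d (\<lambda>s. F (?S + s) (?S + d))\<bar> \<le> d + 1"
        by (rule time_sum_abs_le[OF d(1) summ2[OF I_mult d(1)]], rule bnd)
           (auto intro!: I_add I_mult d(1))
      with e first[OF I_mult d(1), of n] d(3,4) have "\<bar>\<Phi> T - \<Phi> ?S\<bar> \<le> K1"
        unfolding K1_def by (simp add: abs_le_iff)
      moreover have "\<bar>\<Phi> ?S\<bar> \<le> ?S + 1"
        unfolding \<Phi>_def by (intro time_sum_abs_le summ I_mult bnd)
      moreover have "0 < T" "0 < ?S" using T assms n by auto
      \<comment> \<open>The term with \<open>d / ?S\<close> corrects for the change of the
        denominator from \<open>?S\<close> to \<open>T = ?S + d\<close>. It stays bounded because
        \<open>\<Phi>\<close> grows at most linearly.\<close>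
      moreover have "\<Phi> T / T - \<Phi> ?S / ?S = ((\<Phi> T - \<Phi> ?S) - \<Phi> ?S * (d / ?S)) / T"
      proof -
        have *: "y / S = (y + y * (d / S)) / (S + d)" if "0 < S" "0 \<le> d" for y S d :: real
          using that by (simp add: divide_eq_eq eq_divide_eq) (simp add: field_simps)
        have "\<Phi> ?S / ?S = (\<Phi> ?S + \<Phi> ?S * (d / ?S)) / T"
          unfolding d(4) by (rule *[OF calculation(4) d(2)])
        then show ?thesis by (simp only: diff_divide_distrib add_divide_distrib)
      qed
      moreover have "\<bar>\<Phi> ?S * (d / ?S)\<bar> \<le> (?S + 1) * (d / ?S)"
        unfolding abs_mult using calculation(2,4) d(2) by (intro mult_mono) auto
      moreover have "\<bar>(\<Phi> T - \<Phi> ?S) - \<Phi> ?S * (d / ?S)\<bar> \<le> K1 + (?S + 1) * (d / ?S)"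
        by (rule order_trans[OF abs_triangle_ineq4 add_mono[OF calculation(1,6)]])
      ultimately have "\<bar>\<Phi> T / T - \<Phi> ?S / ?S\<bar> \<le> (K1 + (?S + 1) * (d / ?S)) / T"
        by (simp only: abs_divide abs_of_pos divide_right_mono[OF _ less_imp_le])
      also have "(?S + 1) * (d / ?S) \<le> \<gamma> + 1"
      proof -
        have "(S + 1) * (d / S) = d + d / S" if "0 < S" for S :: real
          using that by (simp add: field_simps)
        then have "(?S + 1) * (d / ?S) = d + d / ?S" using \<open>0 < ?S\<close> .
        moreover have "d / ?S \<le> 1"
          unfolding divide_le_eq_1_pos[OF \<open>0 < ?S\<close>] using d(3) \<open>\<gamma> \<le> ?S\<close> by linarith
        ultimately show ?thesis using d(3) by linarith
      qed
      finally have "\<bar>\<Phi> T / T - \<Phi> ?S / ?S\<bar> \<le> (K1 + \<gamma> + 1) / T"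
        using \<open>0 < T\<close> by (simp add: divide_right_mono add.assoc)
      moreover have "T \<le> 2 * ?S" using nT(2) \<open>\<gamma> \<le> ?S\<close> by linarith
      ultimately show ?thesis
        using n(1) by (intro exI[of _ n]) (simp add: a_def mult.commute)
    qed
    obtain m where m: "0 < m" "S0 \<le> 2 * (\<gamma> * real m)" "\<bar>\<Phi> S0 / S0 - a m / real m / \<gamma>\<bar> \<le> (K1 + \<gamma> + 1) / S0"
      using approx ST0 by blast
    obtain n where n: "0 < n" "T0 \<le> 2 * (\<gamma> * real n)" "\<bar>\<Phi> T0 / T0 - a n / real n / \<gamma>\<bar> \<le> (K1 + \<gamma> + 1) / T0"
      using approx ST0 by blast
    have "\<bar>a m / real m / \<gamma> - a n / real n / \<gamma>\<bar> = \<bar>a m / real m - a n / real n\<bar> / \<gamma>"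
      by (simp only: diff_divide_distrib[symmetric] abs_divide abs_of_pos[OF assms(4)])
    also have "\<dots> \<le> (K2 / real m + K2 / real n) / \<gamma>"
      using assms by (intro divide_right_mono quasi_additive_average[OF quasi] m n) auto
    also have "\<dots> = K2 / (\<gamma> * real m) + K2 / (\<gamma> * real n)"
      by (simp add: add_divide_distrib mult.commute)
    also have "\<dots> \<le> 2 * K2 / S0 + 2 * K2 / T0"
    proof (rule add_mono)
      show "K2 / (\<gamma> * real m) \<le> 2 * K2 / S0"
        using mult_left_mono[OF m(2) nonneg(3)] m ST0 assms by (simp add: field_simps)
      show "K2 / (\<gamma> * real n) \<le> 2 * K2 / T0"
        using mult_left_mono[OF n(2) nonneg(3)] n ST0 assms by (simp add: field_simps)
    qed
    finally have "\<bar>\<Phi> S0 / S0 - \<Phi> T0 / T0\<bar> \<le> (K1 + \<gamma> + 1) / S0 + 2 * K2 / S0 + ((K1 + \<gamma> + 1) / T0 + 2 * K2 / T0)"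
      using m(3) n(3) by linarith
    also have "\<dots> = K / S0 + K / T0"
      by (simp add: K_def add_divide_distrib)
    finally show "\<bar>time_sum I S0 (\<lambda>s. F s S0) / S0 - time_sum I T0 (\<lambda>s. F s T0) / T0\<bar> \<le> K / S0 + K / T0"
      by (simp add: \<Phi>_def)
  qed
qed

end

section \<open>The killed process\<close>

text \<open>The infimum need not be attained: a path that enters the absorbing sets immediately
  after \<open>t\<close> has absorption time \<open>t\<close> without being hit up to
  \<open>t\<close>. Hence the margin \<open>t' > t\<close>.\<close>

lemma less_absorption_time_iff:
  "ereal t < absorption_time I A X s \<omega> \<longleftrightarrow>
    (\<exists>t'>t. \<forall>v\<in>I. s \<le> v \<longrightarrow> v < t' \<longrightarrow> X v \<omega> \<notin> A v)"
proof
  assume "ereal t < absorption_time I A X s \<omega>"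
  then obtain t' where t': "ereal t < ereal t'" "ereal t' < absorption_time I A X s \<omega>"
    using ereal_dense2 by blast
  have "X v \<omega> \<notin> A v" if "v \<in> I" "s \<le> v" "v < t'" for v
  proof
    assume "X v \<omega> \<in> A v"
    with that have "absorption_time I A X s \<omega> \<le> ereal v"
      unfolding absorption_time_def by (intro Inf_lower) auto
    then have "ereal t' < ereal v"
      using t'(2) by (rule less_le_trans[rotated])
    with that show False by simp
  qed
  with t' show "\<exists>t'>t. \<forall>v\<in>I. s \<le> v \<longrightarrow> v < t' \<longrightarrow> X v \<omega> \<notin> A v"
    by auto
next
  assume "\<exists>t'>t. \<forall>v\<in>I. s \<le> v \<longrightarrow> v < t' \<longrightarrow> X v \<omega> \<notin> A v"
  then obtain t' where "t < t'" "\<forall>v\<in>I. s \<le> v \<longrightarrow> v < t' \<longrightarrow> X v \<omega> \<notin> A v"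
    by blast
  then have "ereal t' \<le> absorption_time I A X s \<omega>"
    unfolding absorption_time_def by (intro Inf_greatest) force
  with \<open>t < t'\<close> show "ereal t < absorption_time I A X s \<omega>"
    by (meson less_ereal.simps(1) less_le_trans)
qed

context homogeneous_markov_process
begin

abbreviation events_from :: "real \<Rightarrow> 'w set set" where
  "events_from s \<equiv> sets (sigma_gen_by \<Omega> E X (I \<inter> {s..}))"

lemma time_nonneg: "t \<in> I \<Longrightarrow> 0 \<le> t"
  using time_set by (auto simp: Nats_def)

lemma time_zero [simp, intro]: "0 \<in> I"
  using time_set by auto

lemma time_add: "s \<in> I \<Longrightarrow> t \<in> I \<Longrightarrow> s + t \<in> I"
  using time_set by auto

lemma time_diff: "s \<in> I \<Longrightarrow> t \<in> I \<Longrightarrow> s \<le> t \<Longrightarrow> t - s \<in> I"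
proof -
  assume a: "s \<in> I" "t \<in> I" "s \<le> t"
  show "t - s \<in> I"
    using time_set
  proof
    assume "I = \<nat>"
    with a obtain m n where "s = of_nat m" "t = of_nat n" by (auto elim!: Nats_cases)
    with a \<open>I = \<nat>\<close> show ?thesis
      by (metis of_nat_diff of_nat_in_Nats of_nat_le_iff)
  qed (use a in auto)
qed

lemma time_mult_nat: "t \<in> I \<Longrightarrow> real n * t \<in> I"
  by (induction n) (auto simp: algebra_simps intro: time_add)

lemma sets_sigma_gen_by:
  "sets (sigma_gen_by \<Omega> E X J) =
    sigma_sets (space \<Omega>) {X v -` B \<inter> space \<Omega> | v B. v \<in> J \<and> B \<in> sets E}"
  unfolding sigma_gen_by_def by (rule sets_measure_of) auto

lemma space_sigma_gen_by [simp]: "space (sigma_gen_by \<Omega> E X J) = space \<Omega>"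
  unfolding sigma_gen_by_def by (rule space_measure_of) auto

lemma sigma_gen_by_mono: "J \<subseteq> J' \<Longrightarrow>
    sets (sigma_gen_by \<Omega> E X J) \<subseteq> sets (sigma_gen_by \<Omega> E X J')"
  unfolding sets_sigma_gen_by by (rule sigma_sets_mono') auto

lemma sigma_gen_by_subset: "J \<subseteq> I \<Longrightarrow> sets (sigma_gen_by \<Omega> E X J) \<subseteq> sets \<Omega>"
  unfolding sets_sigma_gen_by
  by (intro sets.sigma_sets_subset) (auto intro: measurable_sets[OF X_measurable])

lemma events_from_sets: "G \<in> events_from s \<Longrightarrow> G \<in> sets \<Omega>"
  using sigma_gen_by_subset[of "I \<inter> {s..}"] by auto

lemma events_from_mono: "s \<le> u \<Longrightarrow> G \<in> events_from u \<Longrightarrow> G \<in> events_from s"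
  by (erule subsetD[OF sigma_gen_by_mono, rotated]) auto

lemma coordinate_event:
  assumes "u \<in> I" "s \<le> u" "B \<in> sets E"
  shows "{\<omega> \<in> space \<Omega>. X u \<omega> \<in> B} \<in> events_from s"
proof -
  have "{\<omega> \<in> space \<Omega>. X u \<omega> \<in> B} = X u -` B \<inter> space \<Omega>" by auto
  then show ?thesis
    unfolding sets_sigma_gen_by using assms by (auto intro!: sigma_sets.Basic)
qed

lemma kernel_prob_algebra: "s \<in> I \<Longrightarrow> P s x \<in> space (prob_algebra \<Omega>)"
  using measurable_space[OF kernel] by (simp add: space_E)

lemma prob_space_kernel: "s \<in> I \<Longrightarrow> prob_space (P s x)"
  using kernel_prob_algebra by (auto simp: space_prob_algebra)

lemma sets_kernel: "s \<in> I \<Longrightarrow> sets (P s x) = sets \<Omega>"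
  using kernel_prob_algebra by (auto simp: space_prob_algebra)

lemma space_kernel: "s \<in> I \<Longrightarrow> space (P s x) = space \<Omega>"
  using sets_kernel sets_eq_imp_space_eq by blast

lemma measurable_kernel_event:
  assumes "s \<in> I" "G \<in> sets \<Omega>"
  shows "(\<lambda>x. measure (P s x) G) \<in> borel_measurable E"
  using measurable_compose[OF measurable_prob_algebraD[OF kernel[OF assms(1)]]
      measurable_measure_subprob_algebra[OF assms(2)]] by simp

lemma measure_kernel_le_1: "s \<in> I \<Longrightarrow> measure (P s x) G \<le> 1"
  by (rule prob_space.prob_le_1[OF prob_space_kernel])

text \<open>The almost sure Markov property, integrated over a past event \<open>S\<close>; no
  conditional expectation appears after this point.\<close>

lemma markov_integral:
  assumes su: "s \<in> I" "u \<in> I" "s \<le> u"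
    and S: "S \<in> sets (sigma_gen_by \<Omega> E X (I \<inter> {s..u}))" and G: "G \<in> events_from u"
  shows "measure (P s x) (S \<inter> G) = (\<integral>\<omega>. indicator S \<omega> * measure (P u (X u \<omega>)) G \<partial>P s x)"
proof -
  interpret prob_space "P s x" by (rule prob_space_kernel[OF su(1)])
  let ?F = "sigma_gen_by \<Omega> E X (I \<inter> {s..u})"
  have sub: "sets ?F \<subseteq> sets \<Omega>" by (rule sigma_gen_by_subset) auto
  interpret finite_measure_subalgebra "P s x" ?F
    by unfold_locales (use sub su in \<open>auto simp: subalgebra_def space_kernel sets_kernel\<close>)
  have meas [measurable]: "G \<in> sets (P s x)" "S \<in> sets (P s x)"
    using G S sub su by (auto simp: sets_kernel dest: events_from_sets)
  have "measure (P s x) (S \<inter> G) = (\<integral>\<omega>\<in>S. indicator G \<omega> \<partial>P s x)"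
    unfolding set_lebesgue_integral_def by (simp flip: indicator_inter_arith add: Int_absorb2)
  also have "\<dots> = (\<integral>\<omega>\<in>S. real_cond_exp (P s x) ?F (indicator G) \<omega> \<partial>P s x)"
    by (rule real_cond_exp_intA) (use S in \<open>auto simp: integrable_indicator_iff less_top[symmetric]\<close>)
  also have "\<dots> = (\<integral>\<omega>. indicator S \<omega> * measure (P u (X u \<omega>)) G \<partial>P s x)"
    unfolding set_lebesgue_integral_def
  proof (rule integral_cong_AE)
    have X: "X u \<in> P s x \<rightarrow>\<^sub>M E"
      using X_measurable[OF su(2)] by (simp add: su sets_kernel cong: measurable_cong_sets)
    have [measurable]: "(\<lambda>\<omega>. measure (P u (X u \<omega>)) G) \<in> borel_measurable (P s x)"
      by (rule measurable_compose[OF X measurable_kernel_event[OF su(2) events_from_sets[OF G]]])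
    show "(\<lambda>\<omega>. indicator S \<omega> * measure (P u (X u \<omega>)) G) \<in> borel_measurable (P s x)"
      by measurable
    show "AE \<omega> in P s x. indicator S \<omega> *\<^sub>R real_cond_exp (P s x) ?F (indicator G) \<omega>
        = indicator S \<omega> * measure (P u (X u \<omega>)) G"
      using markov[OF su G, of x] by eventually_elim simp
  qed measurable
  finally show ?thesis .
qed

end

context absorbed_markov_process
begin

definition surv :: "real \<Rightarrow> real \<Rightarrow> 'w set" where
  "surv s t = {\<omega> \<in> space \<Omega>. ereal t < absorption_time I A X s \<omega>}"

definition visit :: "real \<Rightarrow> 'a set \<Rightarrow> 'w set" where
  "visit u B = {\<omega> \<in> space \<Omega>. X u \<omega> \<in> B}"

text \<open>The survival probability. As a function of time and position it is the weight of the
  Doob transform that conditions the process on survival up to \<open>t\<close>.\<close>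

definition h :: "real \<Rightarrow> real \<Rightarrow> 'a \<Rightarrow> real" where
  "h s t x = measure (P s x) (surv s t)"

lemma surv_event_between:
  assumes "s \<in> I" "t \<in> I"
  shows "surv s t \<in> sets (sigma_gen_by \<Omega> E X (I \<inter> {s..t}))"
proof -
  have "surv s t = space (sigma_gen_by \<Omega> E X (I \<inter> {s..t}))
      - {\<omega> \<in> space \<Omega>. absorption_time I A X s \<omega> \<le> ereal t}"
    by (auto simp: surv_def)
  then show ?thesis
    using stopping[OF assms] by (metis sets.compl_sets)
qed

lemma surv_event: "s \<in> I \<Longrightarrow> t \<in> I \<Longrightarrow> surv s t \<in> events_from s"
  by (rule subsetD[OF sigma_gen_by_mono surv_event_between]) auto

lemma surv_sets: "s \<in> I \<Longrightarrow> t \<in> I \<Longrightarrow> surv s t \<in> sets \<Omega>"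
  by (rule events_from_sets[OF surv_event])

lemma visit_event: "u \<in> I \<Longrightarrow> s \<le> u \<Longrightarrow> B \<in> sets E \<Longrightarrow> visit u B \<in> events_from s"
  unfolding visit_def by (rule coordinate_event)

text \<open>The margin beyond \<open>u\<close> in the first survival event overlaps the window that
  starts at \<open>u\<close>, so together the two events exclude hits on one uninterrupted stretch
  beyond \<open>t\<close>.\<close>

lemma surv_split:
  assumes "s \<le> u" "u \<le> t"
  shows "surv s t = surv s u \<inter> surv u t"
proof -
  have "ereal t < absorption_time I A X s \<omega> \<longleftrightarrow>
      ereal u < absorption_time I A X s \<omega> \<and> ereal t < absorption_time I A X u \<omega>" for \<omega>
    unfolding less_absorption_time_iff
  proof safe
    fix t' assume "t < t'" and *: "\<forall>v\<in>I. s \<le> v \<longrightarrow> v < t' \<longrightarrow> X v \<omega> \<notin> A v"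
    with assms show "\<exists>t'>u. \<forall>v\<in>I. s \<le> v \<longrightarrow> v < t' \<longrightarrow> X v \<omega> \<notin> A v"
      by (intro exI[of _ t']) auto
    from \<open>t < t'\<close> * assms show "\<exists>t'>t. \<forall>v\<in>I. u \<le> v \<longrightarrow> v < t' \<longrightarrow> X v \<omega> \<notin> A v"
      by (intro exI[of _ t']) auto
  next
    fix t' u'
    assume "t < t'" and 1: "\<forall>v\<in>I. u \<le> v \<longrightarrow> v < t' \<longrightarrow> X v \<omega> \<notin> A v"
      and "u < u'" and 2: "\<forall>v\<in>I. s \<le> v \<longrightarrow> v < u' \<longrightarrow> X v \<omega> \<notin> A v"
    show "\<exists>t'>t. \<forall>v\<in>I. s \<le> v \<longrightarrow> v < t' \<longrightarrow> X v \<omega> \<notin> A v"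
    proof (intro exI[of _ t'] conjI ballI impI)
      fix v assume "v \<in> I" "s \<le> v" "v < t'"
      with 1 2 \<open>u < u'\<close> show "X v \<omega> \<notin> A v" by (cases "u \<le> v") auto
    qed fact
  qed
  then show ?thesis by (auto simp: surv_def)
qed

lemma surv_not_absorbed:
  assumes "\<omega> \<in> surv s u" "s \<le> u" "u \<in> I"
  shows "X u \<omega> \<notin> A u"
  using assms by (force simp: surv_def less_absorption_time_iff)

lemma h_pos: "s \<in> I \<Longrightarrow> t \<in> I \<Longrightarrow> s \<le> t \<Longrightarrow> x \<in> - A s \<Longrightarrow> 0 < h s t x"
  using survival_pos[of s t x] by (simp add: h_def surv_def space_kernel)

lemma h_bounds: "s \<in> I \<Longrightarrow> 0 \<le> h s t x" "s \<in> I \<Longrightarrow> h s t x \<le> 1"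
  by (auto simp: h_def measure_kernel_le_1)

lemma h_measurable [measurable]: "s \<in> I \<Longrightarrow> t \<in> I \<Longrightarrow> h s t \<in> borel_measurable E"
  unfolding h_def[abs_def] by (rule measurable_kernel_event[OF _ surv_sets])

text \<open>The sub-Markov transition operator from \<open>s\<close> to \<open>u\<close> of the
  process killed at absorption, applied to \<open>g\<close> and evaluated at
  \<open>x\<close>.\<close>

definition killed :: "real \<Rightarrow> real \<Rightarrow> 'a \<Rightarrow> ('a \<Rightarrow> real) \<Rightarrow> real" where
  "killed s u x g = (\<integral>\<omega>. indicator (surv s u) \<omega> * g (X u \<omega>) \<partial>P s x)"

lemma X_measurable_kernel: "s \<in> I \<Longrightarrow> u \<in> I \<Longrightarrow> X u \<in> P s x \<rightarrow>\<^sub>M E"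
  using X_measurable by (simp add: sets_kernel cong: measurable_cong_sets)

lemma killed_integrable:
  fixes g :: "'a \<Rightarrow> real"
  assumes "s \<in> I" "u \<in> I" "g \<in> borel_measurable E" "\<And>y. \<bar>g y\<bar> \<le> K"
  shows "integrable (P s x) (\<lambda>\<omega>. indicator (surv s u) \<omega> * g (X u \<omega>))"
proof -
  interpret prob_space "P s x" by (rule prob_space_kernel[OF assms(1)])
  have [measurable]: "surv s u \<in> sets (P s x)"
    using assms by (simp add: sets_kernel surv_sets)
  have [measurable]: "(\<lambda>\<omega>. g (X u \<omega>)) \<in> borel_measurable (P s x)"
    by (rule measurable_compose[OF X_measurable_kernel assms(3)]) (use assms in auto)
  have "0 \<le> K" using abs_ge_zero assms(4) by (rule order_trans)
  then show ?thesis
    by (intro integrable_const_bound[where B = K]) (auto simp: indicator_def assms(4))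
qed

text \<open>Survivors at time \<open>u\<close> lie outside \<open>A u\<close>, so the integrands
  need to be compared only there. This matters because (A'1) and (A'2) speak only of such
  points.\<close>

lemma killed_mono:
  assumes su: "s \<in> I" "u \<in> I" "s \<le> u"
    and f: "f \<in> borel_measurable E" "\<And>y. \<bar>f y\<bar> \<le> K"
    and g: "g \<in> borel_measurable E" "\<And>y. \<bar>g y\<bar> \<le> K'"
    and le: "\<And>y. y \<in> - A u \<Longrightarrow> f y \<le> g y"
  shows "killed s u x f \<le> killed s u x g"
  unfolding killed_def
proof (rule integral_mono)
  show "indicator (surv s u) \<omega> * f (X u \<omega>) \<le> indicator (surv s u) \<omega> * g (X u \<omega>)" for \<omega>
    using le[of "X u \<omega>"] surv_not_absorbed[OF _ su(3,2)] by (auto simp: indicator_def)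
qed (rule killed_integrable; (use assms in auto))+

lemma killed_cong:
  assumes "u \<in> I" "s \<le> u" "\<And>y. y \<in> - A u \<Longrightarrow> f y = g y"
  shows "killed s u x f = killed s u x g"
  unfolding killed_def
  by (rule Bochner_Integration.integral_cong[OF refl])
     (use assms surv_not_absorbed[OF _ assms(2,1)] in \<open>auto simp: indicator_def\<close>)

lemma killed_diff:
  assumes "s \<in> I" "u \<in> I"
    and f: "f \<in> borel_measurable E" "\<And>y. \<bar>f y\<bar> \<le> K"
    and g: "g \<in> borel_measurable E" "\<And>y. \<bar>g y\<bar> \<le> K'"
  shows "killed s u x (\<lambda>y. f y - g y) = killed s u x f - killed s u x g"
  unfolding killed_def right_diff_distrib
  by (rule Bochner_Integration.integral_diff; rule killed_integrable) (use assms in auto)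

lemma killed_cmult: "killed s u x (\<lambda>y. a * f y) = a * killed s u x f"
  unfolding killed_def
  by (subst Bochner_Integration.integral_mult_right_zero[symmetric])
     (simp add: mult.left_commute)

lemma killed_indicator:
  assumes "s \<in> I" "u \<in> I" "s \<le> u" "B \<in> sets E"
  shows "killed s u x (indicator B) = measure (P s x) (surv s u \<inter> visit u B)"
proof -
  interpret prob_space "P s x" by (rule prob_space_kernel[OF assms(1)])
  have [measurable]: "surv s u \<inter> visit u B \<in> sets (P s x)"
    using assms surv_sets[OF assms(1,2)] events_from_sets[OF visit_event[OF assms(2,3,4)]]
    by (auto simp: sets_kernel)
  have "killed s u x (indicator B) = (\<integral>\<omega>. indicator (surv s u \<inter> visit u B) \<omega> \<partial>P s x)"
    unfolding killed_def
    by (rule Bochner_Integration.integral_cong[OF refl])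
       (auto simp: indicator_def visit_def surv_def)
  also have "\<dots> = measure (P s x) (surv s u \<inter> visit u B)"
    using sets.sets_into_space[OF \<open>surv s u \<inter> visit u B \<in> sets (P s x)\<close>]
    by (simp add: Int_absorb2)
  finally show ?thesis .
qed

lemma measure_surv_Int:
  assumes "s \<in> I" "u \<in> I" "s \<le> u" "G \<in> events_from u"
  shows "measure (P s x) (surv s u \<inter> G) = killed s u x (\<lambda>y. measure (P u y) G)"
  unfolding killed_def by (rule markov_integral) (use assms surv_event_between in auto)

text \<open>The Markov property at \<open>u\<close>: \<open>h\<close> is space-time harmonic for the
  killed process.\<close>

lemma h_eq_killed:
  assumes "s \<in> I" "u \<in> I" "t \<in> I" "s \<le> u" "u \<le> t"
  shows "h s t x = killed s u x (h u t)"
  unfolding h_def[abs_def] surv_split[OF assms(4,5)]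
  using assms by (intro measure_surv_Int surv_event)

lemma cond_marginal_kernel:
  assumes "space Q = space \<Omega>"
  shows "cond_marginal I A X Q s u t B = measure Q (surv s t \<inter> visit u B) / measure Q (surv s t)"
proof -
  have "{\<omega> \<in> space \<Omega>. X u \<omega> \<in> B \<and> ereal t < absorption_time I A X s \<omega>} = surv s t \<inter> visit u B"
    by (auto simp: surv_def visit_def)
  then show ?thesis
    by (simp add: cond_marginal_def cond_prob_def assms surv_def)
qed

end

section \<open>Contraction\<close>

lemma prob_measures_onD:
  assumes "\<mu> \<in> prob_measures_on M F" "F \<in> sets M"
  shows "prob_space \<mu>" "sets \<mu> = sets M" "AE x in \<mu>. x \<in> F"
proof -
  show 1: "prob_space \<mu>" and 2: "sets \<mu> = sets M"
    using assms(1) by (auto simp: prob_measures_on_def space_prob_algebra)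
  show "AE x in \<mu>. x \<in> F"
    using assms 2 by (intro prob_space.AE_in_set_eq_1[OF 1, THEN iffD2])
      (auto simp: prob_measures_on_def measure_def)
qed

context absorbed_markov_process
begin

lemma alive_sets: "s \<in> I \<Longrightarrow> - A s \<in> sets E"
  using sets.compl_sets[OF A_measurable[of s]] by (simp add: space_E Compl_eq_Diff_UNIV)

lemmas initial_lawD = prob_measures_onD[OF _ alive_sets]

lemma measure_bind_kernel:
  assumes "prob_space \<mu>" "sets \<mu> = sets E" "s \<in> I" "G \<in> sets \<Omega>"
  shows "measure (\<mu> \<bind> P s) G = (\<integral>x. measure (P s x) G \<partial>\<mu>)"
proof -
  interpret prob_space \<mu> by fact
  interpret subprob_space \<mu> by unfold_locales
  show ?thesis
    using measurable_prob_algebraD[OF kernel[OF assms(3)]] assms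
    by (intro measure_bind[where N = \<Omega>]) (simp_all cong: measurable_cong_sets)
qed

lemma space_bind_kernel:
  assumes "sets \<mu> = sets E" "s \<in> I"
  shows "space (\<mu> \<bind> P s) = space \<Omega>"
  using assms sets_eq_imp_space_eq[OF assms(1)]
  by (intro space_bind) (auto simp: sets_kernel space_E)

lemma integrable_bounded_initial:
  fixes g :: "'a \<Rightarrow> real"
  assumes "prob_space \<mu>" "sets \<mu> = sets E" "g \<in> borel_measurable E" "\<And>y. \<bar>g y\<bar> \<le> K"
  shows "integrable \<mu> g"
proof -
  interpret prob_space \<mu> by fact
  show ?thesis
    using assms by (intro integrable_const_bound[where B = K]) (auto cong: measurable_cong_sets)
qed

text \<open>The sub-probability law of \<open>X u\<close> on survival is realised as a measure, so
  that the setwise minorization (A'1) can be carried over to integrals by comparing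
  measures.\<close>

lemma emeasure_distr_killed:
  assumes "s \<in> I" "u \<in> I" "s \<le> u" "B \<in> sets E"
  shows "emeasure (distr (density (P s x) (\<lambda>\<omega>. ennreal (indicator (surv s u) \<omega>))) E (X u)) B
    = ennreal (measure (P s x) (surv s u \<inter> visit u B))"
proof -
  interpret prob_space "P s x" by (rule prob_space_kernel[OF assms(1)])
  have [measurable]: "surv s u \<in> sets (P s x)" "X u \<in> P s x \<rightarrow>\<^sub>M E" "visit u B \<in> sets (P s x)"
    using assms surv_sets X_measurable_kernel events_from_sets[OF visit_event[OF assms(2,3,4)]]
    by (auto simp: sets_kernel)
  have eq: "X u -` B \<inter> space (P s x) = visit u B"
    using assms by (auto simp: visit_def space_kernel)
  have "emeasure (distr (density (P s x) (\<lambda>\<omega>. ennreal (indicator (surv s u) \<omega>))) E (X u)) B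
      = emeasure (density (P s x) (\<lambda>\<omega>. ennreal (indicator (surv s u) \<omega>))) (visit u B)"
    by (subst emeasure_distr) (use assms(4) eq in \<open>auto simp: measurable_density_eq1\<close>)
  also have "\<dots> = (\<integral>\<^sup>+\<omega>. indicator (surv s u \<inter> visit u B) \<omega> \<partial>P s x)"
    by (subst emeasure_density) (measurable, intro nn_integral_cong, auto split: split_indicator)
  also have "\<dots> = ennreal (measure (P s x) (surv s u \<inter> visit u B))"
    by (simp add: emeasure_eq_measure)
  finally show ?thesis .
qed

lemma killed_eq_nn_integral:
  assumes su: "s \<in> I" "u \<in> I"
    and g: "g \<in> borel_measurable E" "\<And>y. \<bar>g y\<bar> \<le> K" "\<And>y. 0 \<le> g y"
  shows "ennreal (killed s u x g)
    = (\<integral>\<^sup>+y. ennreal (g y) \<partial>distr (density (P s x) (\<lambda>\<omega>. ennreal (indicator (surv s u) \<omega>))) E (X u))"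
proof -
  note [measurable] = X_measurable_kernel[OF su] g(1)
  have [measurable]: "surv s u \<in> sets (P s x)"
    using su by (simp add: sets_kernel surv_sets)
  have "ennreal (killed s u x g) = (\<integral>\<^sup>+\<omega>. ennreal (indicator (surv s u) \<omega> * g (X u \<omega>)) \<partial>P s x)"
    unfolding killed_def using g
    by (intro nn_integral_eq_integral[symmetric] killed_integrable[OF su]) auto
  also have "\<dots> = (\<integral>\<^sup>+y. ennreal (g y) \<partial>distr (density (P s x) (\<lambda>\<omega>. ennreal (indicator (surv s u) \<omega>))) E (X u))"
    by (subst nn_integral_distr) (auto simp: nn_integral_density ennreal_mult'' g)
  finally show ?thesis .
qed

end

section \<open>Minorization and oscillation for the process conditioned on survival\<close>

locale doeblin_absorbed_process = absorbed_markov_process I E \<Omega> X P A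
  for I :: "real set" and E :: "'a::metric_space measure" and \<Omega> :: "'w measure"
    and X :: "real \<Rightarrow> 'w \<Rightarrow> 'a" and P :: "real \<Rightarrow> 'a \<Rightarrow> 'w measure" and A :: "real \<Rightarrow> 'a set" +
  fixes \<nu> :: "real \<Rightarrow> 'a measure" and t0 c1 c2 :: real
  assumes nu: "\<And>s. s \<in> I \<Longrightarrow> \<nu> s \<in> prob_measures_on E (- A s)"
    and t0: "t0 \<in> I" "t0 > 0"
    and c1: "c1 > 0"
    and c2: "c2 > 0"
    and minorization: "\<And>s x B. s \<in> I \<Longrightarrow> x \<in> - A s \<Longrightarrow> B \<in> sets E \<Longrightarrow>
      cond_marginal I A X (P s x) s (s + t0) (s + t0) B \<ge> c1 * measure (\<nu> (s + t0)) B"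
    and harnack: "\<And>s t x. s \<in> I \<Longrightarrow> t \<in> I \<Longrightarrow> s \<le> t \<Longrightarrow> x \<in> - A s \<Longrightarrow>
      \<P>(\<omega> in \<nu> s \<bind> P s. absorption_time I A X s \<omega> > ereal t)
        \<ge> c2 * \<P>(\<omega> in P s x. absorption_time I A X s \<omega> > ereal t)"
begin

lemmas nuD = initial_lawD[OF nu]

lemma alive_nonempty:
  assumes "s \<in> I" obtains x where "x \<in> - A s"
proof -
  have "emeasure (\<nu> s) (- A s) = 1"
    using nu[OF assms] by (simp add: prob_measures_on_def)
  then have "- A s \<noteq> {}" by (metis emeasure_empty zero_neq_one)
  then show ?thesis using that by blast
qed

definition nu_h :: "real \<Rightarrow> real \<Rightarrow> real" where
  "nu_h s t = (\<integral>x. h s t x \<partial>\<nu> s)"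

lemma h_le_nu_h:
  assumes "s \<in> I" "t \<in> I" "s \<le> t" "x \<in> - A s"
  shows "c2 * h s t x \<le> nu_h s t"
proof -
  have "nu_h s t = measure (\<nu> s \<bind> P s) (surv s t)"
    unfolding nu_h_def h_def using assms
    by (subst measure_bind_kernel) (simp_all add: nuD surv_sets)
  moreover have "space (\<nu> s \<bind> P s) = space \<Omega>"
    using assms by (intro space_bind_kernel nuD)
  ultimately show ?thesis
    using harnack[OF assms] assms by (simp add: h_def surv_def space_kernel)
qed

lemma nu_h_pos:
  assumes "s \<in> I" "t \<in> I" "s \<le> t"
  shows "0 < nu_h s t"
proof -
  obtain x where x: "x \<in> - A s" using alive_nonempty assms(1) by blast
  then have "0 < c2 * h s t x" using h_pos assms c2 by simp
  then show ?thesis using h_le_nu_h[OF assms x] by linarith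
qed

text \<open>By (A'2) the chance to survive from \<open>u\<close> to \<open>T\<close> is at most
  \<open>nu_h u T / c2\<close>, wherever the process is at \<open>u\<close>; the Markov property at
  \<open>u\<close> then separates the survival before \<open>u\<close> from the survival after
  it.\<close>

lemma h_le_h_nu_h:
  assumes "r \<in> I" "u \<in> I" "T \<in> I" "r \<le> u" "u \<le> T"
  shows "c2 * h r T x \<le> h r u x * nu_h u T"
proof -
  have h_abs: "\<bar>c2 * h u T y\<bar> \<le> c2" for y
    using h_bounds[OF assms(2), of T y] c2 by (simp add: abs_mult mult_left_le)
  have "c2 * h r T x = killed r u x (\<lambda>y. c2 * h u T y)"
    using h_eq_killed[OF assms] by (simp add: killed_cmult)
  also have "\<dots> \<le> killed r u x (\<lambda>y. nu_h u T * indicator UNIV y)"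
    using h_measurable[OF assms(2,3)] h_le_nu_h[OF assms(2,3,5)] nu_h_pos[OF assms(2,3,5)] assms
    by (intro killed_mono[OF _ _ _ _ h_abs, where K' = "nu_h u T"]) auto
  also have "\<dots> = nu_h u T * h r u x"
  proof -
    have "surv r u \<inter> visit u UNIV = surv r u" by (auto simp: surv_def visit_def)
    then show ?thesis
      unfolding killed_cmult using assms sets.top[of E]
      by (subst killed_indicator) (auto simp: h_def space_E)
  qed
  finally show ?thesis by (simp add: mult.commute)
qed

text \<open>Extends (A'1) from sets to functions: a setwise inequality between measures passes to
  integrals of nonnegative functions.\<close>

lemma killed_ge_nu:
  assumes s: "s \<in> I" "x \<in> - A s"
    and g: "g \<in> borel_measurable E" "\<And>y. \<bar>g y\<bar> \<le> K" "\<And>y. y \<in> - A (s + t0) \<Longrightarrow> 0 \<le> g y"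
  shows "c1 * h s (s + t0) x * (\<integral>y. g y \<partial>\<nu> (s + t0)) \<le> killed s (s + t0) x g"
proof -
  let ?u = "s + t0"
  \<comment> \<open>\<open>g\<close> may be negative on the absorbing set. Cutting it off there
    changes neither side, since \<open>\<nu> (s + t0)\<close> gives that set no mass and the killed
    process does not reach it alive.\<close>
  define g' where "g' y = indicator (- A ?u) y * g y" for y
  have u: "?u \<in> I" "s \<le> ?u" using s t0 by (auto intro: time_add)
  note nu_u = nuD[OF u(1) u(1)]
  interpret \<nu>: prob_space "\<nu> ?u" by (rule nu_u(1))
  interpret Px: prob_space "P s x" by (rule prob_space_kernel[OF s(1)])
  have K: "0 \<le> K" using abs_ge_zero g(2) by (rule order_trans)
  have g': "g' \<in> borel_measurable E" "\<bar>g' y\<bar> \<le> K" "0 \<le> g' y" for y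
    unfolding g'_def[abs_def] using g(2,3)[of y] K
    by (auto simp: indicator_def[of "- A (s + t0)" y]
        intro!: borel_measurable_times borel_measurable_indicator alive_sets u g(1))
  let ?N = "distr (density (P s x) (\<lambda>\<omega>. ennreal (indicator (surv s ?u) \<omega>))) E (X ?u)"
  let ?k = "c1 * h s ?u x"
  have k: "0 \<le> ?k" using c1 h_bounds(1)[OF s(1)] by simp
  have le: "scale_measure (ennreal ?k) (\<nu> ?u) \<le> ?N"
  proof (subst le_measure)
    show "\<forall>B\<in>sets (scale_measure (ennreal ?k) (\<nu> ?u)).
        emeasure (scale_measure (ennreal ?k) (\<nu> ?u)) B \<le> emeasure ?N B"
    proof
      fix B assume "B \<in> sets (scale_measure (ennreal ?k) (\<nu> ?u))"
      then have B: "B \<in> sets E" by (simp add: nu_u)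
      have "c1 * measure (\<nu> ?u) B \<le> measure (P s x) (surv s ?u \<inter> visit ?u B) / h s ?u x"
        using minorization[OF s B] s by (simp add: cond_marginal_kernel space_kernel h_def)
      then have "?k * measure (\<nu> ?u) B \<le> measure (P s x) (surv s ?u \<inter> visit ?u B)"
        using h_pos[OF s(1) u(1) u(2) s(2)] by (simp add: field_simps)
      then show "emeasure (scale_measure (ennreal ?k) (\<nu> ?u)) B \<le> emeasure ?N B"
        using k by (simp add: emeasure_distr_killed[OF s(1) u B] \<nu>.emeasure_eq_measure
            ennreal_mult''[symmetric])
    qed
  qed (simp add: nu_u)
  have "ennreal (?k * (\<integral>y. g' y \<partial>\<nu> ?u)) = ennreal ?k * (\<integral>\<^sup>+y. ennreal (g' y) \<partial>\<nu> ?u)"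
    using k integrable_bounded_initial[OF nu_u(1,2) g'(1,2)] g'(3)
    by (subst nn_integral_eq_integral) (auto simp: ennreal_mult')
  also have "\<dots> = (\<integral>\<^sup>+y. ennreal (g' y) \<partial>scale_measure (ennreal ?k) (\<nu> ?u))"
    using g'(1) by (subst nn_integral_scale_measure) (auto simp: nu_u cong: measurable_cong_sets)
  also have "\<dots> \<le> (\<integral>\<^sup>+y. ennreal (g' y) \<partial>?N)"
    by (rule nn_integral_mono_measure) (use le in \<open>auto simp: nu_u\<close>)
  also have "\<dots> = ennreal (killed s ?u x g')"
    by (rule killed_eq_nn_integral[symmetric]) (use s u g' in auto)
  finally have "?k * (\<integral>y. g' y \<partial>\<nu> ?u) \<le> killed s ?u x g'"
    by (rule ennreal_le_iff[THEN iffD1, rotated])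
       (simp add: killed_def Bochner_Integration.integral_nonneg g'(3))
  moreover have "(\<integral>y. g' y \<partial>\<nu> ?u) = (\<integral>y. g y \<partial>\<nu> ?u)"
  proof (rule integral_cong_AE)
    show "AE y in \<nu> ?u. g' y = g y"
      using nu_u(3) by eventually_elim (simp add: g'_def)
  qed (use g(1) g'(1) in \<open>simp_all add: nu_u cong: measurable_cong_sets\<close>)
  moreover have "killed s ?u x g' = killed s ?u x g"
    by (rule killed_cong) (use u in \<open>auto simp: g'_def\<close>)
  ultimately show ?thesis by simp
qed

text \<open>Doeblin's condition for the process conditioned on survival up to \<open>T\<close>: its law after a time \<open>t0\<close>
  dominates \<open>c1 * c2\<close> times the probability measure with density \<open>h u T / nu_h u T\<close> with respect to
  \<open>\<nu> u\<close>, whatever the starting point.\<close>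

lemma doeblin_step:
  assumes r: "r \<in> I" "x \<in> - A r" and u: "u = r + t0" "u \<le> T" "T \<in> I"
    and g: "g \<in> borel_measurable E" "\<And>y. \<bar>g y\<bar> \<le> K"
    and m: "\<And>y. y \<in> - A u \<Longrightarrow> m * h u T y \<le> g y"
  shows "(m + c1 * c2 * ((\<integral>y. g y \<partial>\<nu> u) / nu_h u T - m)) * h r T x \<le> killed r u x g"
    and "m \<le> (\<integral>y. g y \<partial>\<nu> u) / nu_h u T"
proof -
  have uI: "u \<in> I" "r \<le> u" using r u t0 by (auto intro: time_add)
  note nu_u = nuD[OF uI(1) uI(1)]
  interpret \<nu>: prob_space "\<nu> u" by (rule nu_u(1))
  have h_abs: "\<bar>h u T y\<bar> \<le> 1" for y using h_bounds[OF uI(1), of T y] by simp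
  have mh: "(\<lambda>y. m * h u T y) \<in> borel_measurable E" "\<And>y. \<bar>m * h u T y\<bar> \<le> \<bar>m\<bar>"
    using h_measurable[OF uI(1) u(3)] h_abs by (auto simp: abs_mult mult_left_le)
  \<comment> \<open>Only the excess of \<open>g\<close> over its known lower bound is nonnegative on
    the alive points, so (A'1) is applied to it. The bound itself is transported exactly, because
    \<open>killed\<close> maps \<open>h u T\<close> to \<open>h r T\<close>.\<close>
  define d where "d y = g y - m * h u T y" for y
  have d: "d \<in> borel_measurable E" "\<And>y. \<bar>d y\<bar> \<le> K + \<bar>m\<bar>" "\<And>y. y \<in> - A u \<Longrightarrow> 0 \<le> d y"
    unfolding d_def[abs_def] using g mh m
    by (auto intro: order_trans[OF abs_triangle_ineq4] add_mono)
  have int: "(\<integral>y. d y \<partial>\<nu> u) = (\<integral>y. g y \<partial>\<nu> u) - m * nu_h u T"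
    unfolding d_def nu_h_def
    using integrable_bounded_initial[OF nu_u(1,2) g]
      integrable_bounded_initial[OF nu_u(1,2) h_measurable[OF uI(1) u(3)] h_abs]
    by (simp add: Bochner_Integration.integral_diff)
  have int_nonneg: "0 \<le> (\<integral>y. d y \<partial>\<nu> u)"
    using nu_u(3) by (intro integral_nonneg_AE) (auto elim!: eventually_mono intro: d)
  have pos: "0 < nu_h u T" using nu_h_pos uI u by simp
  show "m \<le> (\<integral>y. g y \<partial>\<nu> u) / nu_h u T"
    using int int_nonneg pos by (simp add: field_simps)
  have hr: "h r T x = killed r u x (h u T)"
    by (rule h_eq_killed) (use r u uI in auto)
  have "c2 * h r T x \<le> h r u x * nu_h u T"
    by (rule h_le_h_nu_h) (use r u uI in auto)
  then have "c1 * (c2 * h r T x) * ((\<integral>y. d y \<partial>\<nu> u) / nu_h u T)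
      \<le> c1 * (h r u x * nu_h u T) * ((\<integral>y. d y \<partial>\<nu> u) / nu_h u T)"
    using c1 int_nonneg pos by (intro mult_right_mono mult_left_mono) auto
  also have "\<dots> = c1 * h r u x * (\<integral>y. d y \<partial>\<nu> u)"
    using pos by simp
  also have "\<dots> \<le> killed r u x d"
    unfolding u(1) by (rule killed_ge_nu) (use r d u in auto)
  also have "\<dots> = killed r u x g - m * h r T x"
    unfolding d_def[abs_def] using r uI g mh
    by (subst killed_diff) (auto simp: killed_cmult hr)
  finally show "(m + c1 * c2 * ((\<integral>y. g y \<partial>\<nu> u) / nu_h u T - m)) * h r T x \<le> killed r u x g"
    using pos by (simp add: int diff_divide_distrib algebra_simps)
qed

text \<open>The Doeblin step for \<open>g = h t0 t0\<close> and the lower bound 0: the ratio of the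
  integrals is 1, so \<open>c1 * c2\<close> times a positive survival probability is at most that
  probability.\<close>

lemma doeblin_const_le_1: "c1 * c2 \<le> 1"
proof -
  obtain x where x: "x \<in> - A 0" using alive_nonempty time_zero by blast
  have t: "t0 \<in> I" "0 \<le> t0" using t0 by auto
  have "killed 0 t0 x (h t0 t0) = h 0 t0 x"
    by (rule h_eq_killed[symmetric]) (use t in auto)
  moreover have "(c1 * c2) * h 0 t0 x \<le> killed 0 t0 x (h t0 t0)"
    using doeblin_step(1)[OF time_zero x, of t0 t0 "h t0 t0" 1 0] t h_bounds[OF t(1)] h_measurable[OF t(1) t(1)]
      nu_h_pos[OF t(1) t(1)]
    by (simp add: nu_h_def)
  ultimately show ?thesis
    using h_pos[OF time_zero t(1) t(2) x] by simp
qed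

text \<open>After division by \<open>h\<close> the bounds are bounds on a conditional probability given survival up to \<open>T\<close>,
  uniform in the starting point, except that \<open>G\<close> need not imply survival up to \<open>T\<close>; this freedom is
  used to compare two horizons.\<close>

lemma oscillation_decay:
  assumes "r \<in> I" "s \<in> I" "T \<in> I" "r + real n * t0 \<le> s" "s \<le> T" "G \<in> events_from s"
    and bounds: "\<And>y. y \<in> - A s \<Longrightarrow>
      m * h s T y \<le> measure (P s y) G \<and> measure (P s y) G \<le> M * h s T y"
  shows "\<exists>m'\<ge>m. \<forall>x\<in>- A r. m' * h r T x \<le> measure (P r x) (surv r s \<inter> G) \<and>
    measure (P r x) (surv r s \<inter> G) \<le> (m' + (1 - c1 * c2) ^ n * (M - m)) * h r T x"
  using assms(1,4)
proof (induction n arbitrary: r)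
  case 0
  then have rs: "r \<le> s" by simp
  note G = events_from_sets[OF assms(6)]
  have abs: "\<bar>k * h s T y\<bar> \<le> \<bar>k\<bar>" "\<bar>measure (P s y) G\<bar> \<le> 1" for y k
    using h_bounds[OF assms(2), of T y] measure_kernel_le_1[OF assms(2)]
    by (auto simp: abs_mult mult_left_le)
  have eq: "measure (P r x) (surv r s \<inter> G) = killed r s x (\<lambda>y. measure (P s y) G)" for x
    by (rule measure_surv_Int) (use 0 assms rs in auto)
  have eq_h: "k * h r T x = killed r s x (\<lambda>y. k * h s T y)" for k x
    unfolding killed_cmult using h_eq_killed[OF 0(1) assms(2,3) rs assms(5)] by simp
  have meas: "(\<lambda>y. k * h s T y) \<in> borel_measurable E" "(\<lambda>y. measure (P s y) G) \<in> borel_measurable E" for k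
    using h_measurable[OF assms(2,3)] measurable_kernel_event[OF assms(2) G] by auto
  have "m * h r T x \<le> measure (P r x) (surv r s \<inter> G)" for x
    unfolding eq eq_h
    by (rule killed_mono[OF 0(1) assms(2) rs meas(1) abs(1) meas(2) abs(2)]) (use bounds in auto)
  moreover have "measure (P r x) (surv r s \<inter> G) \<le> M * h r T x" for x
    unfolding eq eq_h
    by (rule killed_mono[OF 0(1) assms(2) rs meas(2) abs(2) meas(1) abs(1)]) (use bounds in auto)
  ultimately show ?case by (intro exI[of _ m]) simp
next
  case (Suc n)
  \<comment> \<open>The induction moves the starting time back: the event and the time
    \<open>s\<close> stay fixed, and one step of length \<open>t0\<close> is prepended.\<close>
  define u where "u = r + t0"
  have u: "u \<in> I" "u + real n * t0 \<le> s" "r \<le> u"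
    using Suc.prems t0 by (auto simp: u_def algebra_simps intro: time_add)
  moreover have "0 \<le> real n * t0" using t0 by simp
  ultimately have u: "u \<in> I" "u + real n * t0 \<le> s" "r \<le> u" "u \<le> s" by auto
  obtain m' where m': "m \<le> m'" "\<And>x. x \<in> - A u \<Longrightarrow> m' * h u T x \<le> measure (P u x) (surv u s \<inter> G)"
      "\<And>x. x \<in> - A u \<Longrightarrow> measure (P u x) (surv u s \<inter> G) \<le> (m' + (1 - c1 * c2) ^ n * (M - m)) * h u T x"
    using Suc.IH[OF u(1,2)] by blast
  define M' where "M' = m' + (1 - c1 * c2) ^ n * (M - m)"
  let ?G = "surv u s \<inter> G"
  have ev: "?G \<in> events_from u"
    using surv_event[OF u(1) assms(2)] events_from_mono[OF u(4) assms(6)] by auto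
  define g where "g y = measure (P u y) ?G" for y
  define p where "p = (\<integral>y. g y \<partial>\<nu> u) / nu_h u T"
  have g: "g \<in> borel_measurable E" "(\<lambda>y. - g y) \<in> borel_measurable E"
      "\<bar>g y\<bar> \<le> 1" "\<bar>- g y\<bar> \<le> 1" for y
    unfolding g_def[abs_def]
    using measurable_kernel_event[OF u(1) events_from_sets[OF ev]] measure_kernel_le_1[OF u(1)] by auto
  have eq: "measure (P r x) (surv r s \<inter> G) = killed r u x g" for x
    unfolding g_def[abs_def] surv_split[OF u(3,4)] Int_assoc
    by (rule measure_surv_Int) (use u Suc ev in auto)
  note step = doeblin_step[OF Suc.prems(1) _ u_def order_trans[OF u(4) assms(5)] assms(3)]
  show ?case
  \<comment> \<open>Both bounds move towards \<open>p\<close>, the mean of the conditional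
    probability under the minorizing law, by the fraction \<open>c1 * c2\<close> of their distance
    to it. The gap shrinks by \<open>1 - c1 * c2\<close>, whatever \<open>p\<close> is.\<close>
  proof (intro exI[of _ "m' + c1 * c2 * (p - m')"] conjI ballI)
    have "m' \<le> p" if "x \<in> - A r" for x
      unfolding p_def using g m' by (intro step(2)[OF that]) (auto simp: g_def)
    moreover obtain x where "x \<in> - A r" using alive_nonempty Suc.prems(1) by blast
    ultimately show "m \<le> m' + c1 * c2 * (p - m')"
      using m'(1) c1 c2 by (simp add: add_increasing2)
  next
    fix x assume x: "x \<in> - A r"
    show "(m' + c1 * c2 * (p - m')) * h r T x \<le> measure (P r x) (surv r s \<inter> G)"
      unfolding eq p_def using g m' by (intro step(1)[OF x]) (auto simp: g_def)
    \<comment> \<open>The upper bound is the lower bound for \<open>- g\<close>, which is why the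
      Doeblin step allows signed functions.\<close>
    have "(- M' + c1 * c2 * ((\<integral>y. - g y \<partial>\<nu> u) / nu_h u T - (- M'))) * h r T x
        \<le> killed r u x (\<lambda>y. - g y)"
      by (rule step(1)[OF x g(2,4)]) (simp only: mult_minus_left neg_le_iff_le g_def M'_def m'(3))
    then have "killed r u x g \<le> (M' - c1 * c2 * (M' - p)) * h r T x"
      using killed_cmult[of r u x "-1" g] by (simp add: p_def algebra_simps)
    also have "M' - c1 * c2 * (M' - p) = m' + c1 * c2 * (p - m') + (1 - c1 * c2) ^ Suc n * (M - m)"
      by (simp add: M'_def algebra_simps)
    finally show "measure (P r x) (surv r s \<inter> G)
        \<le> (m' + c1 * c2 * (p - m') + (1 - c1 * c2) ^ Suc n * (M - m)) * h r T x"
      unfolding eq .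
  qed
qed

end

section \<open>Conditional laws started from an initial distribution\<close>

context absorbed_markov_process
begin

lemma visit_sets: "u \<in> I \<Longrightarrow> B \<in> sets E \<Longrightarrow> visit u B \<in> sets \<Omega>"
  by (rule events_from_sets[OF visit_event[OF _ order.refl]])

lemma visit_UNIV: "surv s t \<inter> visit u UNIV = surv s t"
  by (auto simp: surv_def visit_def)

lemma UNIV_sets: "UNIV \<in> sets E"
  using sets.top[of E] by (simp add: space_E)

text \<open>The process starts at \<open>y\<close> almost surely, so the visit at the starting time
  is decided by \<open>y\<close> alone.\<close>

lemma measure_Int_visit_start:
  assumes "s \<in> I" "B \<in> sets E" "S \<in> sets \<Omega>"
  shows "measure (P s y) (S \<inter> visit s B) = indicator B y * measure (P s y) S"
proof -
  interpret prob_space "P s y" by (rule prob_space_kernel[OF assms(1)])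
  \<comment> \<open>Measurability is read off from \<open>start\<close>: a set that is not an event
    has measure 0 by convention, not 1.\<close>
  have "{\<omega> \<in> space (P s y). X s \<omega> = y} \<in> events"
    using start[OF assms(1), of y] measure_notin_sets by fastforce
  then have "AE \<omega> in P s y. X s \<omega> = y"
    using start[OF assms(1), of y] by (simp add: prob_Collect_eq_1)
  moreover have "S \<inter> visit s B \<in> events" "S \<in> events"
    using assms visit_sets by (auto simp: sets_kernel)
  ultimately have "prob (S \<inter> visit s B) = prob (if y \<in> B then S else {})"
    using assms(1)
    by (intro finite_measure_eq_AE)
       (auto elim!: eventually_mono simp: visit_def sets_kernel dest: sets.sets_into_space)
  then show ?thesis by simp
qed

text \<open>The unnormalised conditional law. Written as an integral over the starting point, it
  inherits inequalities that hold for every alive point; division by its value at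
  \<open>UNIV\<close> gives \<open>cond_law\<close>.\<close>

definition joint_mass :: "'a measure \<Rightarrow> real \<Rightarrow> real \<Rightarrow> 'a set \<Rightarrow> real" where
  "joint_mass \<mu> s t B = (\<integral>x. measure (P 0 x) (surv 0 t \<inter> visit s B) \<partial>\<mu>)"

definition cond_law :: "'a measure \<Rightarrow> real \<Rightarrow> real \<Rightarrow> 'a set \<Rightarrow> real" where
  "cond_law \<mu> s t B = cond_marginal I A X (\<mu> \<bind> P 0) 0 s t B"

context
  fixes \<mu> assumes mu: "\<mu> \<in> prob_measures_on E (- A 0)"
begin

lemmas muD = initial_lawD[OF mu time_zero]

lemma joint_mass_integrable:
  assumes "s \<in> I" "t \<in> I" "B \<in> sets E"
  shows "integrable \<mu> (\<lambda>x. measure (P 0 x) (surv 0 t \<inter> visit s B))"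
  using assms surv_sets visit_sets
  by (intro integrable_bounded_initial[OF muD(1,2), where K = 1] measurable_kernel_event)
     (auto simp: measure_kernel_le_1)

lemma joint_mass_mono:
  assumes "s \<in> I" "t \<in> I" "B \<in> sets E" "s' \<in> I" "t' \<in> I" "B' \<in> sets E"
    and "\<And>x. x \<in> - A 0 \<Longrightarrow> a * measure (P 0 x) (surv 0 t \<inter> visit s B)
      \<le> b * measure (P 0 x) (surv 0 t' \<inter> visit s' B')"
  shows "a * joint_mass \<mu> s t B \<le> b * joint_mass \<mu> s' t' B'"
proof -
  have "(\<integral>x. a * measure (P 0 x) (surv 0 t \<inter> visit s B) \<partial>\<mu>)
      \<le> (\<integral>x. b * measure (P 0 x) (surv 0 t' \<inter> visit s' B') \<partial>\<mu>)"
  proof (rule integral_mono_AE)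
    show "AE x in \<mu>. a * measure (P 0 x) (surv 0 t \<inter> visit s B)
        \<le> b * measure (P 0 x) (surv 0 t' \<inter> visit s' B')"
      using muD(3) by eventually_elim (use assms in auto)
  qed (use joint_mass_integrable assms in auto)
  then show ?thesis by (simp add: joint_mass_def)
qed

lemma joint_mass_UNIV_pos:
  assumes "s \<in> I" "t \<in> I"
  shows "0 < joint_mass \<mu> s t UNIV"
proof -
  interpret prob_space \<mu> by (rule muD(1))
  have eq: "joint_mass \<mu> s t UNIV = (\<integral>x. h 0 t x \<partial>\<mu>)"
    by (simp add: joint_mass_def visit_UNIV h_def)
  have "integrable \<mu> (h 0 t)"
    using joint_mass_integrable[OF assms UNIV_sets] by (simp add: visit_UNIV h_def[abs_def])
  moreover have "AE x in \<mu>. 0 < h 0 t x"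
    using muD(3) by eventually_elim (use h_pos assms time_nonneg in auto)
  ultimately have "(\<integral>x. 0 \<partial>\<mu>) < (\<integral>x. h 0 t x \<partial>\<mu>)"
    by (intro integral_less_AE_space) (auto simp: emeasure_space_1)
  then show ?thesis by (simp add: eq)
qed

lemma cond_law_eq:
  assumes "s \<in> I" "t \<in> I" "B \<in> sets E"
  shows "cond_law \<mu> s t B = joint_mass \<mu> s t B / joint_mass \<mu> s t UNIV"
  using assms surv_sets[OF time_zero assms(2)] visit_sets[OF assms(1,3)]
  by (simp add: cond_law_def cond_marginal_kernel space_bind_kernel muD measure_bind_kernel
      joint_mass_def visit_UNIV sets.Int)

lemma prob_space_bind_initial: "prob_space (\<mu> \<bind> P 0)" "sets (\<mu> \<bind> P 0) = sets \<Omega>"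
proof -
  have k: "P 0 \<in> \<mu> \<rightarrow>\<^sub>M prob_algebra \<Omega>"
    using kernel[OF time_zero] by (simp add: muD cong: measurable_cong_sets)
  show "prob_space (\<mu> \<bind> P 0)"
    using muD(1) by (intro prob_space_bind'[OF _ k]) (simp add: space_prob_algebra)
  show "sets (\<mu> \<bind> P 0) = sets \<Omega>"
    using muD(1) by (intro sets_bind'[OF _ k]) (simp add: space_prob_algebra)
qed

lemma cond_law_eq_measure:
  assumes "s \<in> I" "t \<in> I"
  shows "cond_law \<mu> s t B = measure (\<mu> \<bind> P 0) (surv 0 t \<inter> visit s B) / measure (\<mu> \<bind> P 0) (surv 0 t)"
    and "0 < measure (\<mu> \<bind> P 0) (surv 0 t)"
  using joint_mass_UNIV_pos[OF assms] surv_sets[OF time_zero assms(2)]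
  by (simp_all add: cond_law_def cond_marginal_kernel space_bind_kernel muD measure_bind_kernel
      joint_mass_def visit_UNIV)

lemma cond_law_bounds:
  assumes "s \<in> I" "t \<in> I"
  shows "0 \<le> cond_law \<mu> s t B" "cond_law \<mu> s t B \<le> 1" "cond_law \<mu> s t UNIV = 1"
proof -
  interpret prob_space "\<mu> \<bind> P 0" by (rule prob_space_bind_initial(1))
  have "prob (surv 0 t \<inter> visit s B) \<le> prob (surv 0 t)"
    using surv_sets[OF time_zero assms(2)]
    by (intro finite_measure_mono) (auto simp: prob_space_bind_initial)
  then show "0 \<le> cond_law \<mu> s t B" "cond_law \<mu> s t B \<le> 1" "cond_law \<mu> s t UNIV = 1"
    using cond_law_eq_measure[OF assms] by (auto simp: visit_UNIV)
qed

lemma cond_law_sums: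
  assumes "s \<in> I" "t \<in> I" "range B \<subseteq> sets E" "disjoint_family B"
  shows "(\<lambda>i. cond_law \<mu> s t (B i)) sums cond_law \<mu> s t (\<Union>i. B i)"
proof -
  interpret prob_space "\<mu> \<bind> P 0" by (rule prob_space_bind_initial(1))
  have eq: "surv 0 t \<inter> visit s (\<Union>i. B i) = (\<Union>i. surv 0 t \<inter> visit s (B i))"
    by (auto simp: visit_def)
  have "(\<lambda>i. prob (surv 0 t \<inter> visit s (B i))) sums prob (\<Union>i. surv 0 t \<inter> visit s (B i))"
  proof (rule finite_measure_UNION)
    show "range (\<lambda>i. surv 0 t \<inter> visit s (B i)) \<subseteq> events"
      using surv_sets[OF time_zero assms(2)] visit_sets[OF assms(1)] assms(3)
      by (auto simp: prob_space_bind_initial)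
    show "disjoint_family (\<lambda>i. surv 0 t \<inter> visit s (B i))"
      using assms(4) by (auto simp: disjoint_family_on_def visit_def)
  qed
  then show ?thesis
    unfolding cond_law_eq_measure(1)[OF assms(1,2)] eq by (rule sums_divide)
qed

end

end

section \<open>Periodicity: forgetting the initial law and the starting time\<close>

locale periodic_doeblin_process = doeblin_absorbed_process I E \<Omega> X P A \<nu> t0 c1 c2
  for I :: "real set" and E :: "'a::metric_space measure" and \<Omega> :: "'w measure"
    and X :: "real \<Rightarrow> 'w \<Rightarrow> 'a" and P :: "real \<Rightarrow> 'a \<Rightarrow> 'w measure" and A :: "real \<Rightarrow> 'a set"
    and \<nu> :: "real \<Rightarrow> 'a measure" and t0 c1 c2 :: real +
  fixes \<gamma> :: real
  assumes gamma: "\<gamma> \<in> I" "\<gamma> > 0"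
    and periodic: "\<And>t. t \<in> I \<Longrightarrow> A (t + \<gamma>) = A t"
begin

lemma periodic_mult:
  assumes "t \<in> I" shows "A (t + real k * \<gamma>) = A t"
proof (induction k)
  case (Suc k)
  have "A (t + real (Suc k) * \<gamma>) = A ((t + real k * \<gamma>) + \<gamma>)"
    by (simp add: algebra_simps)
  also have "\<dots> = A (t + real k * \<gamma>)"
    using assms gamma by (intro periodic time_add time_mult_nat)
  finally show ?case using Suc by simp
qed simp

text \<open>Both sides evaluate one set of paths, which periodicity makes independent of the number
  of periods; time-homogeneity then applies.\<close>

lemma measure_time_shift:
  fixes k :: nat
  assumes s: "s \<in> I" and T: "T \<in> I" and B: "B \<in> sets E"
  defines "u \<equiv> real k * \<gamma>"
  shows "measure (P u y) (surv u (T + u) \<inter> visit (s + u) B) = measure (P 0 y) (surv 0 T \<inter> visit s B)"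
proof -
  \<comment> \<open>Survival beyond \<open>T\<close> and the visit at \<open>s\<close> as one set of
    paths. In continuous time it constrains uncountably many instants; time-homogeneity still covers
    it, because the stopping assumption makes both preimages events.\<close>
  define D where "D = {w. w s \<in> B \<and> (\<exists>t'>T. \<forall>v\<in>I. v < t' \<longrightarrow> w v \<notin> A v)}"
  have u: "u \<in> I" "0 \<le> u" using gamma by (auto simp: u_def intro: time_mult_nat)
  have 0: "{\<omega> \<in> space \<Omega>. (\<lambda>v\<in>I. X (0 + v) \<omega>) \<in> D} = surv 0 T \<inter> visit s B"
    using s by (auto simp: D_def surv_def visit_def less_absorption_time_iff time_nonneg cong: ball_cong)
  have "(\<exists>t'>T. \<forall>v\<in>I. v < t' \<longrightarrow> X (u + v) \<omega> \<notin> A v) \<longleftrightarrow>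
      (\<exists>t'>T + u. \<forall>v\<in>I. u \<le> v \<longrightarrow> v < t' \<longrightarrow> X v \<omega> \<notin> A v)" for \<omega>
  proof safe
    fix t' assume "T < t'" and *: "\<forall>v\<in>I. v < t' \<longrightarrow> X (u + v) \<omega> \<notin> A v"
    have "X v \<omega> \<notin> A v" if "v \<in> I" "u \<le> v" "v < t' + u" for v
      using *[rule_format, of "v - u"] that u periodic_mult[of "v - u" k] time_diff[of u v]
      by (simp add: u_def)
    with \<open>T < t'\<close> show "\<exists>t'>T + u. \<forall>v\<in>I. u \<le> v \<longrightarrow> v < t' \<longrightarrow> X v \<omega> \<notin> A v"
      by (intro exI[of _ "t' + u"]) auto
  next
    fix t' assume "T + u < t'" and *: "\<forall>v\<in>I. u \<le> v \<longrightarrow> v < t' \<longrightarrow> X v \<omega> \<notin> A v"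
    have "X (u + v) \<omega> \<notin> A v" if "v \<in> I" "v < t' - u" for v
      using *[rule_format, of "u + v"] that u periodic_mult[of v k] time_nonneg[of v] time_add[of u v]
      by (simp add: u_def add.commute)
    with \<open>T + u < t'\<close> show "\<exists>t'>T. \<forall>v\<in>I. v < t' \<longrightarrow> X (u + v) \<omega> \<notin> A v"
      by (intro exI[of _ "t' - u"]) auto
  qed
  then have 1: "{\<omega> \<in> space \<Omega>. (\<lambda>v\<in>I. X (u + v) \<omega>) \<in> D} = surv u (T + u) \<inter> visit (s + u) B"
    using s by (auto simp: D_def surv_def visit_def less_absorption_time_iff add.commute cong: ball_cong)
  have "surv 0 T \<inter> visit s B \<in> events_from 0"
    using surv_event[OF time_zero T] visit_event[OF s time_nonneg[OF s] B] by auto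
  moreover have "surv u (T + u) \<inter> visit (s + u) B \<in> events_from u"
    using surv_event[OF u(1) time_add[OF T u(1)]] visit_event[OF time_add[OF s u(1)], of u, OF _ B]
      time_nonneg[OF s] by auto
  ultimately show ?thesis
    using time_homogeneous[of u 0 D y] 0 1 u by (simp add: space_kernel)
qed

text \<open>The same \<open>m\<close> serves all initial laws and all numbers of periods: waiting
  \<open>k\<close> periods only replaces the starting point by the random position of a survivor,
  and the bounds hold from every alive point.\<close>

lemma cond_law_oscillation:
  assumes "s \<in> I" "T \<in> I" "s \<le> T" "real n * t0 \<le> s" "B \<in> sets E"
  shows "\<exists>m. \<forall>\<mu>\<in>prob_measures_on E (- A 0). \<forall>k::nat.
    m \<le> cond_law \<mu> (s + real k * \<gamma>) (T + real k * \<gamma>) B \<and>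
    cond_law \<mu> (s + real k * \<gamma>) (T + real k * \<gamma>) B \<le> m + (1 - c1 * c2) ^ n"
proof -
  have s: "0 \<le> s" "0 \<le> T" using assms time_nonneg by auto
  let ?g = "\<lambda>B y. measure (P 0 y) (surv 0 T \<inter> visit s B)"
  have ev: "surv s T \<inter> visit s B \<in> events_from s"
    using surv_event[OF assms(1,2)] visit_event[OF assms(1) _ assms(5)] by auto
  \<comment> \<open>Before any contraction the conditional probability lies between 0 and 1, so the
    initial gap is 1.\<close>
  have "0 * h s T y \<le> measure (P s y) (surv s T \<inter> visit s B) \<and>
      measure (P s y) (surv s T \<inter> visit s B) \<le> 1 * h s T y" for y
  proof -
    interpret prob_space "P s y" by (rule prob_space_kernel[OF assms(1)])
    show ?thesis
      using surv_sets[OF assms(1,2)]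
      by (auto simp: h_def sets_kernel[OF assms(1)] intro!: finite_measure_mono)
  qed
  from oscillation_decay[OF time_zero assms(1,2) _ assms(3) ev this, of n] assms(4)
  obtain m where m: "\<And>x. x \<in> - A 0 \<Longrightarrow> m * h 0 T x \<le> ?g B x"
      "\<And>x. x \<in> - A 0 \<Longrightarrow> ?g B x \<le> (m + (1 - c1 * c2) ^ n) * h 0 T x"
    by (auto simp: surv_split[OF s(1) assms(3)] Int_assoc)
  have g_UNIV: "?g UNIV = h 0 T" by (simp add: visit_UNIV h_def[abs_def])
  show ?thesis
  proof (intro exI[of _ m] ballI allI)
    fix \<mu> and k :: nat assume mu: "\<mu> \<in> prob_measures_on E (- A 0)"
    define u where "u = real k * \<gamma>"
    have u: "u \<in> I" "0 \<le> u" "s + u \<in> I" "T + u \<in> I" "A u = A 0"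
      using gamma assms periodic_mult[OF time_zero, of k] by (auto simp: u_def intro: time_mult_nat time_add)
    have g_meas: "(\<lambda>y. a * ?g B y) \<in> borel_measurable E" "\<bar>a * ?g B y\<bar> \<le> \<bar>a\<bar>"
      if "B \<in> sets E" for B a y
      using surv_sets[OF time_zero assms(2)] visit_sets[OF assms(1) that]
        measurable_kernel_event[OF time_zero, of "surv 0 T \<inter> visit s B"]
      by (auto simp: abs_mult measure_kernel_le_1 mult_left_le)
    \<comment> \<open>The Markov property at \<open>u\<close> restarts the process after
      \<open>k\<close> complete periods, and the time shift turns the restart into a start at time
      0.\<close>
    have eq: "measure (P 0 x) (surv 0 (T + u) \<inter> visit (s + u) B) = killed 0 u x (?g B)"
      if "B \<in> sets E" for x B
    proof -
      have "surv 0 (T + u) \<inter> visit (s + u) B = surv 0 u \<inter> (surv u (T + u) \<inter> visit (s + u) B)"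
        using surv_split[OF u(2), of "T + u"] s by auto
      moreover have "surv u (T + u) \<inter> visit (s + u) B \<in> events_from u"
        using surv_event[OF u(1,4)] visit_event[OF u(3) _ that, of u] s by auto
      ultimately show ?thesis
        using measure_surv_Int[OF time_zero u(1,2)] measure_time_shift[OF assms(1,2) that, of k]
        by (simp add: u_def)
    qed
    have cmp: "a * joint_mass \<mu> (s + u) (T + u) B1 \<le> b * joint_mass \<mu> (s + u) (T + u) B2"
      if B12: "B1 \<in> sets E" "B2 \<in> sets E" and le: "\<And>y. y \<in> - A 0 \<Longrightarrow> a * ?g B1 y \<le> b * ?g B2 y" for a b B1 B2
    proof (rule joint_mass_mono[OF mu u(3,4) B12(1) u(3,4) B12(2)])
      fix x
      have "killed 0 u x (\<lambda>y. a * ?g B1 y) \<le> killed 0 u x (\<lambda>y. b * ?g B2 y)"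
        by (rule killed_mono[OF time_zero u(1,2) g_meas[OF B12(1)] g_meas[OF B12(2)]])
           (use le u in auto)
      then show "a * measure (P 0 x) (surv 0 (T + u) \<inter> visit (s + u) B1)
          \<le> b * measure (P 0 x) (surv 0 (T + u) \<inter> visit (s + u) B2)"
        by (simp add: eq[OF B12(1)] eq[OF B12(2)] killed_cmult)
    qed
    have "m * joint_mass \<mu> (s + u) (T + u) UNIV \<le> 1 * joint_mass \<mu> (s + u) (T + u) B"
      by (rule cmp[OF UNIV_sets assms(5)]) (use m(1) g_UNIV in \<open>simp add: fun_eq_iff\<close>)
    moreover have "1 * joint_mass \<mu> (s + u) (T + u) B
        \<le> (m + (1 - c1 * c2) ^ n) * joint_mass \<mu> (s + u) (T + u) UNIV"
      by (rule cmp[OF assms(5) UNIV_sets]) (use m(2) g_UNIV in \<open>simp add: fun_eq_iff\<close>)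
    ultimately show "m \<le> cond_law \<mu> (s + real k * \<gamma>) (T + real k * \<gamma>) B \<and>
        cond_law \<mu> (s + real k * \<gamma>) (T + real k * \<gamma>) B \<le> m + (1 - c1 * c2) ^ n"
      using joint_mass_UNIV_pos[OF mu u(3,4)] cond_law_eq[OF mu u(3,4) assms(5)]
      by (simp add: u_def[symmetric] divide_le_eq le_divide_eq)
  qed
qed

end

section \<open>Forgetting the horizon\<close>

context doeblin_absorbed_process
begin

text \<open>The ratio \<open>h s T' x / h s T x\<close> is nearly the same for all alive
  \<open>x\<close>. One step before \<open>T\<close>, (A'1) and (A'2) bound it between
  \<open>c1 * p\<close> and \<open>p / c2\<close>; \<open>oscillation_decay\<close>, with survival
  up to \<open>T'\<close> as the event and \<open>T\<close> as the horizon, contracts this range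
  over the remaining \<open>n\<close> steps.\<close>

lemma h_horizon:
  assumes "s \<in> I" "T \<in> I" "T' \<in> I" "s + real (Suc n) * t0 \<le> T" "T \<le> T'"
  shows "\<exists>q>0. \<forall>x\<in>- A s. q * h s T x \<le> h s T' x \<and>
    h s T' x \<le> q * (1 + (1 - c1 * c2) ^ n / (c1 * c2)) * h s T x"
proof -
  define v where "v = T - t0"
  have "0 \<le> real n * t0" using t0 by simp
  moreover have "s + real n * t0 \<le> v"
    using assms(4) by (simp add: v_def algebra_simps)
  ultimately have sv: "s + real n * t0 \<le> v" "s \<le> v" "v \<le> T" "v \<le> T'"
    using assms(5) t0(2) unfolding v_def by linarith+
  have v: "v \<in> I" "T = v + t0"
    unfolding v_def using assms(2) t0 sv(2) time_nonneg[OF assms(1)]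
    by (auto intro!: time_diff simp: v_def)
  define p where "p = nu_h T T'"
  have p: "0 < p" unfolding p_def using nu_h_pos assms by simp
  have "(c1 * p) * h v T y \<le> measure (P v y) (surv v T') \<and>
      measure (P v y) (surv v T') \<le> (p / c2) * h v T y" if y: "y \<in> - A v" for y
  proof
    have "c1 * h v T y * (\<integral>z. h T T' z \<partial>\<nu> T) \<le> killed v T y (h T T')"
      unfolding v(2) using y v(1) assms h_bounds[OF assms(2)] h_measurable[OF assms(2,3)]
      by (intro killed_ge_nu[where K = 1]) (auto simp: v(2)[symmetric])
    also have "\<dots> = measure (P v y) (surv v T')"
      using h_eq_killed[OF v(1) assms(2,3) sv(3) assms(5)] by (simp add: h_def)
    finally show "(c1 * p) * h v T y \<le> measure (P v y) (surv v T')"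
      by (simp add: p_def nu_h_def algebra_simps)
    show "measure (P v y) (surv v T') \<le> (p / c2) * h v T y"
      using h_le_h_nu_h[OF v(1) assms(2,3) sv(3) assms(5), of y] c2
      by (simp add: p_def h_def field_simps)
  qed
  from oscillation_decay[OF assms(1) v(1) assms(2) sv(1,3) surv_event[OF v(1) assms(3)] this]
  obtain q where q: "c1 * p \<le> q" "\<And>x. x \<in> - A s \<Longrightarrow> q * h s T x \<le> h s T' x"
      "\<And>x. x \<in> - A s \<Longrightarrow> h s T' x \<le> (q + (1 - c1 * c2) ^ n * (p / c2 - c1 * p)) * h s T x"
    by (auto simp: surv_split[OF sv(2,4), symmetric] h_def)
  have "0 < q" using q(1) p c1 by (meson less_le_trans mult_pos_pos)
  \<comment> \<open>Contraction never lowers the lower bound, so \<open>c1 * p \<le> q\<close>; this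
    turns the absolute gap into a gap relative to \<open>q\<close>, free of
    \<open>p\<close>.\<close>
  have "p / c2 - c1 * p \<le> q / (c1 * c2)"
  proof -
    have "p / c2 - c1 * p \<le> (c1 * p) / (c1 * c2)" using c1 p by simp
    also have "\<dots> \<le> q / (c1 * c2)" using q(1) c1 c2 by (intro divide_right_mono) auto
    finally show ?thesis .
  qed
  then have "(1 - c1 * c2) ^ n * (p / c2 - c1 * p) \<le> (1 - c1 * c2) ^ n * (q / (c1 * c2))"
    using doeblin_const_le_1 by (intro mult_left_mono) auto
  then have le: "q + (1 - c1 * c2) ^ n * (p / c2 - c1 * p) \<le> q * (1 + (1 - c1 * c2) ^ n / (c1 * c2))"
    by (simp add: algebra_simps)
  show ?thesis
    using \<open>0 < q\<close> q(2) q(3) mult_right_mono[OF le h_bounds(1)[OF assms(1)]]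
    by (intro exI[of _ q]) (blast intro: order_trans)
qed

text \<open>Passing from \<open>T\<close> to \<open>T'\<close> multiplies numerator and denominator
  by factors between \<open>q\<close> and \<open>q * (1 + \<delta>)\<close>. The unknown
  \<open>q\<close> cancels, the quotient changes by a factor of at most \<open>1 + \<delta>\<close>
  either way, and as both quotients are probabilities this is an additive error
  \<open>\<delta>\<close>.\<close>

lemma cond_law_horizon:
  assumes mu: "\<mu> \<in> prob_measures_on E (- A 0)"
    and "s \<in> I" "T \<in> I" "T' \<in> I" "s + real (Suc n) * t0 \<le> T" "T \<le> T'" "B \<in> sets E"
  shows "\<bar>cond_law \<mu> s T' B - cond_law \<mu> s T B\<bar> \<le> (1 - c1 * c2) ^ n / (c1 * c2)"
proof -
  define \<delta> where "\<delta> = (1 - c1 * c2) ^ n / (c1 * c2)"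
  have \<delta>: "0 \<le> \<delta>" using doeblin_const_le_1 c1 c2 by (simp add: \<delta>_def)
  obtain q where q: "q > 0" "\<And>x. x \<in> - A s \<Longrightarrow> q * h s T x \<le> h s T' x"
      "\<And>x. x \<in> - A s \<Longrightarrow> h s T' x \<le> q * (1 + \<delta>) * h s T x"
    using h_horizon[OF assms(2-6)] unfolding \<delta>_def by blast
  have "0 \<le> real (Suc n) * t0" using t0 by simp
  then have s: "0 \<le> s" "s \<le> T" "s \<le> T'" using assms time_nonneg by auto
  let ?g = "\<lambda>T B y. indicator B y * h s T y"
  have g_meas: "(\<lambda>y. a * ?g T B y) \<in> borel_measurable E" "\<bar>a * ?g T B y\<bar> \<le> \<bar>a\<bar>"
    if "B \<in> sets E" "T \<in> I" for B T a y
    using that h_measurable[OF assms(2) that(2)] h_bounds[OF assms(2), of T y]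
    by (auto simp: abs_mult mult_left_le indicator_def[of B y])
  have eq: "measure (P 0 x) (surv 0 T \<inter> visit s B) = killed 0 s x (?g T B)"
    if "T \<in> I" "s \<le> T" "B \<in> sets E" for x T B
  proof -
    have "surv 0 T \<inter> visit s B = surv 0 s \<inter> (surv s T \<inter> visit s B)"
      using surv_split[OF s(1) that(2)] by auto
    moreover have "surv s T \<inter> visit s B \<in> events_from s"
      using surv_event[OF assms(2) that(1)] visit_event[OF assms(2) _ that(3)] by auto
    ultimately show ?thesis
      using measure_surv_Int[OF time_zero assms(2) s(1)]
        measure_Int_visit_start[OF assms(2) that(3) surv_sets[OF assms(2) that(1)]]
      by (simp add: h_def)
  qed
  have cmp: "a * joint_mass \<mu> s T1 B \<le> b * joint_mass \<mu> s T2 B"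
    if T12: "T1 \<in> I" "T2 \<in> I" "s \<le> T1" "s \<le> T2" and B: "B \<in> sets E"
      and le: "\<And>y. y \<in> - A s \<Longrightarrow> a * h s T1 y \<le> b * h s T2 y" for a b T1 T2 B
  proof (rule joint_mass_mono[OF mu assms(2) T12(1) B assms(2) T12(2) B])
    fix x
    have "killed 0 s x (\<lambda>y. a * ?g T1 B y) \<le> killed 0 s x (\<lambda>y. b * ?g T2 B y)"
      by (rule killed_mono[OF time_zero assms(2) s(1) g_meas[OF B T12(1)] g_meas[OF B T12(2)]])
         (use le in \<open>auto simp: indicator_def\<close>)
    then show "a * measure (P 0 x) (surv 0 T1 \<inter> visit s B) \<le> b * measure (P 0 x) (surv 0 T2 \<inter> visit s B)"
      by (simp add: eq[OF T12(1,3) B] eq[OF T12(2,4) B] killed_cmult)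
  qed
  have lower: "q * joint_mass \<mu> s T B \<le> joint_mass \<mu> s T' B"
    and upper: "joint_mass \<mu> s T' B \<le> q * (1 + \<delta>) * joint_mass \<mu> s T B"
    if "B \<in> sets E" for B
    using cmp[OF assms(3,4) s(2,3) that, of q 1] cmp[OF assms(4,3) s(3,2) that, of 1] q by auto
  define N D N' D' where "N = joint_mass \<mu> s T B" and "D = joint_mass \<mu> s T UNIV"
    and "N' = joint_mass \<mu> s T' B" and "D' = joint_mass \<mu> s T' UNIV"
  have pos: "0 < D" "0 < D'" "0 \<le> N" "0 \<le> N'"
    using joint_mass_UNIV_pos[OF mu assms(2)] assms(3,4)
    by (auto simp: D_def D'_def N_def N'_def joint_mass_def)
  have bnds: "q * N \<le> N'" "N' \<le> q * (1 + \<delta>) * N" "q * D \<le> D'" "D' \<le> q * (1 + \<delta>) * D"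
    unfolding N_def D_def N'_def D'_def by (intro lower upper UNIV_sets assms(7))+
  have F: "cond_law \<mu> s T B = N / D" "cond_law \<mu> s T' B = N' / D'"
    using cond_law_eq[OF mu assms(2) _ assms(7)] assms(3,4) by (auto simp: N_def N'_def D_def D'_def)
  have le1: "N / D \<le> 1" "N' / D' \<le> 1"
    using cond_law_bounds(2)[OF mu assms(2)] assms(3,4) by (auto simp: F[symmetric])
  have "N' / D' \<le> (q * (1 + \<delta>) * N) / (q * D)"
    using bnds pos q \<delta> by (intro frac_le) auto
  also have "\<dots> = N / D + \<delta> * (N / D)" using q(1) pos(1) by (simp add: field_simps)
  also have "\<dots> \<le> N / D + \<delta>" by (intro add_left_mono mult_left_le le1 \<delta>)
  finally have "N' / D' - N / D \<le> \<delta>" by simp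
  moreover have "N / D = (q * N) / (q * D)" using q by simp
  moreover have "(q * N) / (q * D) \<le> N' / (D' / (1 + \<delta>))"
    using bnds pos q \<delta> by (intro frac_le) (auto simp: field_simps)
  moreover have "N' / (D' / (1 + \<delta>)) = N' / D' + \<delta> * (N' / D')"
    by (simp add: add_divide_distrib algebra_simps)
  moreover have "\<delta> * (N' / D') \<le> \<delta>" by (intro mult_left_le le1 \<delta>)
  ultimately show ?thesis unfolding F \<delta>_def[symmetric] by linarith
qed

end

section \<open>Convergence of the time averages\<close>

lemma (in homogeneous_markov_process) time_real: "real n \<in> I"
  using time_set by auto

text \<open>\<open>time_integrals\<close> asks that the conditional marginals be measurable in time,
  which gives the integrals in \<open>time_average\<close> their meaning: the Bochner integral of a
  non-measurable function is 0 by convention.\<close>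

locale averaged_doeblin_process = periodic_doeblin_process I E \<Omega> X P A \<nu> t0 c1 c2 \<gamma>
  for I :: "real set" and E :: "'a::metric_space measure" and \<Omega> :: "'w measure"
    and X :: "real \<Rightarrow> 'w \<Rightarrow> 'a" and P :: "real \<Rightarrow> 'a \<Rightarrow> 'w measure" and A :: "real \<Rightarrow> 'a set"
    and \<nu> :: "real \<Rightarrow> 'a measure" and t0 c1 c2 \<gamma> :: real +
  assumes time_integrals: "\<And>\<mu> t B. I = {0..} \<Longrightarrow> \<mu> \<in> prob_measures_on E (- A 0) \<Longrightarrow> t \<in> I \<Longrightarrow>
      B \<in> sets borel \<Longrightarrow>
      (\<lambda>s. cond_marginal I A X (\<mu> \<bind> P 0) 0 s t B) \<in> borel_measurable (lebesgue_on {0..t})"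
begin

sublocale time_line I
  by unfold_locales (rule time_set)

text \<open>Turns step counts into exponential rates, with one pair of constants for both kinds of
  forgetting. The last estimate is used twice: with equal laws for the shift by periods, and with
  \<open>k = 0\<close> for two initial laws.\<close>

lemma cond_law_estimates:
  obtains \<kappa> C where "0 < \<kappa>" "0 < C"
    "\<And>\<mu> s T T' B. \<mu> \<in> prob_measures_on E (- A 0) \<Longrightarrow> s \<in> I \<Longrightarrow> T \<in> I \<Longrightarrow> T' \<in> I \<Longrightarrow> s \<le> T \<Longrightarrow>
      T \<le> T' \<Longrightarrow> B \<in> sets E \<Longrightarrow> \<bar>cond_law \<mu> s T' B - cond_law \<mu> s T B\<bar> \<le> C * exp (- \<kappa> * (T - s))"
    "\<And>\<mu> \<mu>' s T B k. \<mu> \<in> prob_measures_on E (- A 0) \<Longrightarrow> \<mu>' \<in> prob_measures_on E (- A 0) \<Longrightarrow>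
      s \<in> I \<Longrightarrow> T \<in> I \<Longrightarrow> s \<le> T \<Longrightarrow> B \<in> sets E \<Longrightarrow>
      \<bar>cond_law \<mu> (s + real k * \<gamma>) (T + real k * \<gamma>) B - cond_law \<mu>' s T B\<bar> \<le> C * exp (- \<kappa> * s)"
proof -
  define a where "a = 1 - c1 * c2"
  have a: "0 \<le> a" "a < 1" using doeblin_const_le_1 c1 c2 by (auto simp: a_def)
  have c: "0 < c1 * c2" using c1 c2 by simp
  obtain \<kappa> C where \<kappa>: "0 < \<kappa>" "0 < C"
      and le: "\<And>x. 0 \<le> x \<Longrightarrow> a ^ (nat \<lfloor>x / t0\<rfloor> - 1) \<le> C * exp (- \<kappa> * x)"
    using geometric_le_exp[OF a t0(2)] by blast
  have le': "a ^ (nat \<lfloor>x / t0\<rfloor> - 1) / (c1 * c2) \<le> C / (c1 * c2) * exp (- \<kappa> * x)" if "0 \<le> x" for x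
    using divide_right_mono[OF le[OF that], of "c1 * c2"] c by simp
  show thesis
  proof (rule that[OF \<kappa>(1), of "C / (c1 * c2)"])
    show "0 < C / (c1 * c2)" using \<kappa> c by simp
  next
    fix \<mu> s T T' B
    assume *: "\<mu> \<in> prob_measures_on E (- A 0)" "s \<in> I" "T \<in> I" "T' \<in> I" "s \<le> T" "T \<le> T'" "B \<in> sets E"
    let ?n = "nat \<lfloor>(T - s) / t0\<rfloor>"
    have "\<bar>cond_law \<mu> s T' B - cond_law \<mu> s T B\<bar> \<le> a ^ (?n - 1) / (c1 * c2)"
    \<comment> \<open>If no complete step fits between \<open>s\<close> and \<open>T\<close>, the
      trivial bound 1 suffices, since \<open>1 \<le> 1 / (c1 * c2)\<close>.\<close>
    proof (cases "?n = 0")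
      case True
      have "\<bar>cond_law \<mu> s T' B - cond_law \<mu> s T B\<bar> \<le> 1"
        using cond_law_bounds(1,2)[OF *(1,2,3), of B] cond_law_bounds(1,2)[OF *(1,2,4), of B] by linarith
      also have "\<dots> \<le> a ^ (?n - 1) / (c1 * c2)"
        unfolding True using c doeblin_const_le_1 by simp
      finally show ?thesis .
    next
      case False
      then have "real (Suc (?n - 1)) \<le> (T - s) / t0" by simp
      then have "s + real (Suc (?n - 1)) * t0 \<le> T"
        using t0(2) by (simp only: pos_le_divide_eq)
      then show ?thesis
        using cond_law_horizon[OF *(1-4) _ *(6,7)] by (simp add: a_def)
    qed
    also have "\<dots> \<le> C / (c1 * c2) * exp (- \<kappa> * (T - s))" using * by (intro le') simp
    finally show "\<bar>cond_law \<mu> s T' B - cond_law \<mu> s T B\<bar> \<le> C / (c1 * c2) * exp (- \<kappa> * (T - s))" .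
  next
    fix \<mu> \<mu>' s T B and k :: nat
    assume *: "\<mu> \<in> prob_measures_on E (- A 0)" "\<mu>' \<in> prob_measures_on E (- A 0)"
      "s \<in> I" "T \<in> I" "s \<le> T" "B \<in> sets E"
    have s: "0 \<le> s" using * time_nonneg by simp
    let ?n = "nat \<lfloor>s / t0\<rfloor>"
    have "real ?n \<le> s / t0" using s t0 by simp
    then have "real ?n * t0 \<le> s" using t0(2) by (simp only: pos_le_divide_eq)
    from cond_law_oscillation[OF *(3-5) this *(6)]
    obtain m where m: "\<And>\<mu> k. \<mu> \<in> prob_measures_on E (- A 0) \<Longrightarrow>
        m \<le> cond_law \<mu> (s + real k * \<gamma>) (T + real k * \<gamma>) B \<and>
        cond_law \<mu> (s + real k * \<gamma>) (T + real k * \<gamma>) B \<le> m + a ^ ?n"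
      unfolding a_def by blast
    \<comment> \<open>Both values lie in the same interval of length \<open>a ^ ?n\<close>; the
      second one is the case of no shift.\<close>
    have "\<bar>cond_law \<mu> (s + real k * \<gamma>) (T + real k * \<gamma>) B - cond_law \<mu>' s T B\<bar> \<le> a ^ ?n"
      using m[OF *(1), of k] m[OF *(2), of 0] by simp linarith
    also have "\<dots> \<le> a ^ (?n - 1)" using a by (intro power_decreasing) auto
    also have "\<dots> \<le> a ^ (?n - 1) / (c1 * c2)"
      using a c doeblin_const_le_1 by (simp add: le_divide_eq mult_left_le)
    also have "\<dots> \<le> C / (c1 * c2) * exp (- \<kappa> * s)" by (rule le'[OF s])
    finally show "\<bar>cond_law \<mu> (s + real k * \<gamma>) (T + real k * \<gamma>) B - cond_law \<mu>' s T B\<bar>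
      \<le> C / (c1 * c2) * exp (- \<kappa> * s)" .
  qed
qed

lemma borel_sets_E: "B \<in> sets borel \<Longrightarrow> B \<in> sets E"
  using borel_subset_E by auto

context
  fixes \<mu> assumes mu: "\<mu> \<in> prob_measures_on E (- A 0)"
begin

lemma cond_law_integrable:
  assumes "I = {0..}" "t \<in> I" "B \<in> sets borel"
  shows "integrable (lebesgue_on {0..t}) (\<lambda>s. cond_law \<mu> s t B)"
proof -
  interpret finite_measure "lebesgue_on {0..t}" by (rule finite_measure_lebesgue_on) simp
  have "\<bar>cond_law \<mu> s t B\<bar> \<le> 1" if "s \<in> {0..t}" for s
    using cond_law_bounds(1,2)[OF mu _ assms(2), of s B] that assms(1) by auto
  then show ?thesis
    using time_integrals[OF assms(1) mu assms(2,3)]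
    by (intro integrable_const_bound[where B = 1]) (auto simp: cond_law_def)
qed

lemma cond_law_summable:
  assumes "t \<in> I" "B \<in> sets borel"
  shows "time_summable I t (\<lambda>s. cond_law \<mu> s t B)"
proof (cases "I = \<nat>")
  case False
  then have "I = {0..}" using time_set by blast
  from integrable_on_lebesgue_on[OF cond_law_integrable[OF this assms]]
  show ?thesis by (simp add: time_summable_def)
qed (simp add: time_summable_def)

text \<open>In continuous time this is dominated convergence: the partial sums are bounded by the
  conditional probability of the union, hence by 1.\<close>

lemma time_sum_cond_law_sums:
  assumes t: "t \<in> I" and B: "range B \<subseteq> sets borel" "disjoint_family B"
  shows "(\<lambda>i. time_sum I t (\<lambda>s. cond_law \<mu> s t (B i))) sums time_sum I t (\<lambda>s. cond_law \<mu> s t (\<Union>i. B i))"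
proof -
  have Bi: "B i \<in> sets borel" "B i \<in> sets E" "(\<Union>i. B i) \<in> sets borel" for i
    using B borel_sets_E by auto
  then have sums: "(\<lambda>i. cond_law \<mu> s t (B i)) sums cond_law \<mu> s t (\<Union>i. B i)" if "s \<in> I" for s
    using B that t by (intro cond_law_sums[OF mu]) auto
  from t show ?thesis
  proof (cases rule: time_cases)
    case (2 n)
    have "(\<lambda>i. \<Sum>k\<le>n. cond_law \<mu> (real k) (real n) (B i)) sums (\<Sum>k\<le>n. cond_law \<mu> (real k) (real n) (\<Union>i. B i))"
      using sums 2 by (intro sums_sum) simp
    then show ?thesis by (simp add: 2 time_sum_Nats)
  next
    case 1
    let ?L = "lebesgue_on {0..t}"
    have eq: "time_sum I t (\<lambda>s. cond_law \<mu> s t C) = (\<integral>s. cond_law \<mu> s t C \<partial>?L)" if "C \<in> sets borel" for C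
      using cond_law_integrable[OF 1(1) t that]
      by (simp add: 1(1) time_sum_atLeast lebesgue_integral_eq_integral)
    have sI: "s \<in> I" if "s \<in> space ?L" for s using that 1 by simp
    have "(\<lambda>n. \<integral>s. (\<Sum>i<n. cond_law \<mu> s t (B i)) \<partial>?L) \<longlonglongrightarrow> (\<integral>s. cond_law \<mu> s t (\<Union>i. B i) \<partial>?L)"
    proof (rule integral_dominated_convergence[where w = "\<lambda>_. 1"])
      show "(\<lambda>s. cond_law \<mu> s t (\<Union>i. B i)) \<in> borel_measurable ?L"
        by (rule borel_measurable_integrable[OF cond_law_integrable[OF 1(1) t Bi(3)]])
      show "(\<lambda>s. \<Sum>i<n. cond_law \<mu> s t (B i)) \<in> borel_measurable ?L" for n
        by (intro borel_measurable_sum borel_measurable_integrable[OF cond_law_integrable[OF 1(1) t Bi(1)]])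
      show "integrable ?L (\<lambda>_. 1 :: real)" by simp
      show "AE s in ?L. (\<lambda>n. \<Sum>i<n. cond_law \<mu> s t (B i)) \<longlonglongrightarrow> cond_law \<mu> s t (\<Union>i. B i)"
        using sums sI by (intro AE_I2) (auto simp: sums_def)
      show "AE s in ?L. norm (\<Sum>i<n. cond_law \<mu> s t (B i)) \<le> 1" for n
      proof (rule AE_I2)
        fix s assume "s \<in> space ?L"
        note s = sI[OF this]
        have nonneg: "0 \<le> cond_law \<mu> s t (B i)" for i by (rule cond_law_bounds[OF mu s t])
        have "(\<Sum>i<n. cond_law \<mu> s t (B i)) \<le> (\<Sum>i. cond_law \<mu> s t (B i))"
          using sums_summable[OF sums[OF s]] nonneg by (intro sum_le_suminf) auto
        also have "\<dots> = cond_law \<mu> s t (\<Union>i. B i)" using sums[OF s] by (simp add: sums_iff)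
        also have "\<dots> \<le> 1" by (rule cond_law_bounds[OF mu s t])
        finally show "norm (\<Sum>i<n. cond_law \<mu> s t (B i)) \<le> 1"
          using nonneg by (simp add: sum_nonneg)
      qed
    qed
    then show ?thesis
      unfolding eq[OF Bi(1)] eq[OF Bi(3)] sums_def
      using cond_law_integrable[OF 1(1) t Bi(1)] by (simp add: Bochner_Integration.integral_sum)
  qed
qed

text \<open>\<open>measure_of\<close> yields the zero measure unless its set function is a measure,
  so countable additivity has to be checked before any value can be read off. The Lebesgue integral
  in the definition is matched with \<open>time_sum\<close> here.\<close>

lemma time_average_measure:
  assumes t: "t \<in> I" "0 < t"
  shows "sets (time_average I A X (\<mu> \<bind> P 0) t) = sets borel"
    and "finite_measure (time_average I A X (\<mu> \<bind> P 0) t)"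
    and "B \<in> sets borel \<Longrightarrow> measure (time_average I A X (\<mu> \<bind> P 0) t) B =
      time_sum I t (\<lambda>s. cond_law \<mu> s t B) / t"
proof -
  let ?M = "time_average I A X (\<mu> \<bind> P 0) t"
  let ?f = "\<lambda>B. 1 / t * (if I = \<nat> then (\<Sum>k | k \<in> \<nat> \<and> k \<le> t. cond_marginal I A X (\<mu> \<bind> P 0) 0 k t B)
      else (\<integral>s. cond_marginal I A X (\<mu> \<bind> P 0) 0 s t B \<partial>lebesgue_on {0..t}))"
  have sets_M: "sets ?M = sets borel"
    unfolding time_average_def using sets.sigma_sets_eq[of "borel :: 'a measure"] by simp
  then show "sets ?M = sets borel" .
  have f: "?f B = time_sum I t (\<lambda>s. cond_law \<mu> s t B) / t" if "B \<in> sets borel" for B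
    unfolding time_sum_def
  proof (cases "I = \<nat>")
    case True
    then show "?f B = (if I = \<nat> then \<Sum>k | k \<in> \<nat> \<and> k \<le> t. cond_law \<mu> k t B
        else integral {0..t} (\<lambda>s. cond_law \<mu> s t B)) / t"
      unfolding cond_law_def by simp
  next
    case False
    then have "I = {0..}" using time_set by auto
    from cond_law_integrable[OF this t(1) that] False
    show "?f B = (if I = \<nat> then \<Sum>k | k \<in> \<nat> \<and> k \<le> t. cond_law \<mu> k t B
        else integral {0..t} (\<lambda>s. cond_law \<mu> s t B)) / t"
      by (simp add: lebesgue_integral_eq_integral cond_law_def)
  qed
  have nonneg: "0 \<le> time_sum I t (\<lambda>s. cond_law \<mu> s t B) / t" if "B \<in> sets borel" for B
  proof -
    have "\<bar>time_sum I t (\<lambda>_. 0) - time_sum I t (\<lambda>_. 0)\<bar> \<le> time_sum I t (\<lambda>s. cond_law \<mu> s t B)"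
      using cond_law_bounds(1)[OF mu _ t(1)]
      by (intro time_sum_diff_le t cond_law_summable that time_summable_continuous) auto
    then show ?thesis using t by simp
  qed
  have em: "emeasure ?M B = ennreal (time_sum I t (\<lambda>s. cond_law \<mu> s t B) / t)" if B: "B \<in> sets borel" for B
  proof -
    have "emeasure ?M B = ennreal (?f B)"
    proof (rule emeasure_measure_of[OF time_average_def])
      show "positive (sets ?M) (\<lambda>B. ennreal (?f B))"
        by (simp add: positive_def cond_marginal_def cond_prob_def)
      show "countably_additive (sets ?M) (\<lambda>B. ennreal (?f B))"
      proof (rule countably_additiveI)
        fix B :: "nat \<Rightarrow> 'a set"
        assume "range B \<subseteq> sets ?M" and dis: "disjoint_family B" and "(\<Union>i. B i) \<in> sets ?M"
        then have B: "range B \<subseteq> sets borel" "B i \<in> sets borel" "(\<Union>i. B i) \<in> sets borel" for i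
          using sets_M by auto
        have "(\<lambda>i. time_sum I t (\<lambda>s. cond_law \<mu> s t (B i)) / t) sums (time_sum I t (\<lambda>s. cond_law \<mu> s t (\<Union>i. B i)) / t)"
          by (intro sums_divide time_sum_cond_law_sums t(1) B dis)
        then have "(\<Sum>i. ennreal (time_sum I t (\<lambda>s. cond_law \<mu> s t (B i)) / t))
            = ennreal (time_sum I t (\<lambda>s. cond_law \<mu> s t (\<Union>i. B i)) / t)"
          using nonneg B by (simp add: suminf_ennreal2 sums_iff)
        then show "(\<Sum>i. ennreal (?f (B i))) = ennreal (?f (\<Union>i. B i))"
          by (simp only: f[OF B(2)] f[OF B(3)])
      qed
    qed (use B sets_M in auto)
    then show ?thesis by (simp only: f[OF B])
  qed
  have "space ?M = UNIV" using sets_eq_imp_space_eq[OF sets_M] by simp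
  then show "finite_measure ?M" by (intro finite_measureI) (simp add: em)
  show "measure ?M B = time_sum I t (\<lambda>s. cond_law \<mu> s t B) / t" if "B \<in> sets borel"
    using nonneg[OF that] by (simp add: measure_def em[OF that])
qed

lemma time_average_mass:
  assumes t: "t \<in> I" "0 < t"
  shows "measure (time_average I A X (\<mu> \<bind> P 0) t) UNIV = (if I = \<nat> then 1 + 1 / t else 1)"
proof -
  have "\<bar>time_sum I t (\<lambda>s. cond_law \<mu> s t UNIV) - time_sum I t (\<lambda>s. 1)\<bar> \<le> time_sum I t (\<lambda>_. 0)"
    using cond_law_bounds(3)[OF mu _ t(1)]
    by (intro time_sum_diff_le t cond_law_summable time_summable_continuous) auto
  moreover have "time_sum I t (\<lambda>_. 0) = 0" by (simp add: time_sum_def)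
  ultimately show ?thesis
    using t by (simp add: time_average_measure time_sum_one add_divide_distrib)
qed

end

text \<open>The limit is constructed from one initial law along one sequence of times; every other
  initial law is compared with the reference law at the same time \<open>T\<close>, where their
  integrals differ by at most \<open>C * K0\<close>.\<close>

lemma time_average_setwise_limit:
  obtains \<beta> K where "prob_space \<beta>" "sets \<beta> = sets borel"
    "\<And>\<mu> T B. \<mu> \<in> prob_measures_on E (- A 0) \<Longrightarrow> T \<in> I \<Longrightarrow> \<gamma> \<le> T \<Longrightarrow> B \<in> sets borel \<Longrightarrow>
      \<bar>measure (time_average I A X (\<mu> \<bind> P 0) T) B - measure \<beta> B\<bar> \<le> K / T"
proof -
  obtain \<kappa> C where \<kappa>: "0 < \<kappa>" "0 < C"
    and horizon: "\<And>\<mu> s T T' B. \<mu> \<in> prob_measures_on E (- A 0) \<Longrightarrow> s \<in> I \<Longrightarrow> T \<in> I \<Longrightarrow> T' \<in> I \<Longrightarrow> s \<le> T \<Longrightarrow>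
      T \<le> T' \<Longrightarrow> B \<in> sets E \<Longrightarrow> \<bar>cond_law \<mu> s T' B - cond_law \<mu> s T B\<bar> \<le> C * exp (- \<kappa> * (T - s))"
    and shift: "\<And>\<mu> \<mu>' s T B k. \<mu> \<in> prob_measures_on E (- A 0) \<Longrightarrow> \<mu>' \<in> prob_measures_on E (- A 0) \<Longrightarrow>
      s \<in> I \<Longrightarrow> T \<in> I \<Longrightarrow> s \<le> T \<Longrightarrow> B \<in> sets E \<Longrightarrow>
      \<bar>cond_law \<mu> (s + real k * \<gamma>) (T + real k * \<gamma>) B - cond_law \<mu>' s T B\<bar> \<le> C * exp (- \<kappa> * s)"
    by (rule cond_law_estimates, rule that)
  obtain K0 where K0: "0 \<le> K0" "\<And>T. T \<in> I \<Longrightarrow> time_sum I T (\<lambda>s. exp (- \<kappa> * s)) \<le> K0"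
    by (rule time_sum_exp[OF \<kappa>(1)], rule that)
  obtain K1 where K1: "0 \<le> K1" "\<And>F S T. \<lbrakk>exponentially_forgetful \<gamma> C \<kappa> F; S \<in> I; T \<in> I; \<gamma> \<le> S; \<gamma> \<le> T\<rbrakk>
    \<Longrightarrow> \<bar>time_sum I S (\<lambda>s. F s S) / S - time_sum I T (\<lambda>s. F s T) / T\<bar> \<le> K1 / S + K1 / T"
    by (rule time_average_Cauchy[OF \<kappa>(1) less_imp_le[OF \<kappa>(2)] gamma], rule that)
  define M where "M \<mu> T = time_average I A X (\<mu> \<bind> P 0) T" for \<mu> T
  have Cauchy: "\<bar>measure (M \<mu> S) B - measure (M \<mu> T) B\<bar> \<le> K1 / S + K1 / T"
    if mu: "\<mu> \<in> prob_measures_on E (- A 0)" and ST: "S \<in> I" "T \<in> I" "\<gamma> \<le> S" "\<gamma> \<le> T" and B: "B \<in> sets borel"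
    for \<mu> S T B
  proof -
    have pos: "0 < S" "0 < T" using ST gamma by auto
    have "\<bar>cond_law \<mu> s T B\<bar> \<le> 1" if "s \<in> I" "T \<in> I" for s T
      using cond_law_bounds(1,2)[OF mu that, of B] by simp
    then have "exponentially_forgetful \<gamma> C \<kappa> (\<lambda>s T. cond_law \<mu> s T B)"
      unfolding exponentially_forgetful_def
      by (intro conjI ballI allI impI cond_law_summable[OF mu] horizon[OF mu] shift[OF mu mu]
          borel_sets_E[OF B] B)
    then have "\<bar>time_sum I S (\<lambda>s. cond_law \<mu> s S B) / S - time_sum I T (\<lambda>s. cond_law \<mu> s T B) / T\<bar> \<le> K1 / S + K1 / T"
      by (rule K1(2)[OF _ ST])
    then show ?thesis
      unfolding M_def time_average_measure(3)[OF mu ST(1) pos(1) B]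
        time_average_measure(3)[OF mu ST(2) pos(2) B] .
  qed
  have initial: "\<bar>measure (M \<mu> T) B - measure (M \<mu>' T) B\<bar> \<le> C * K0 / T"
    if mu: "\<mu> \<in> prob_measures_on E (- A 0)" "\<mu>' \<in> prob_measures_on E (- A 0)"
      and T: "T \<in> I" "\<gamma> \<le> T" and B: "B \<in> sets borel" for \<mu> \<mu>' T B
  proof -
    have pos: "0 < T" using T gamma by auto
    have "\<bar>time_sum I T (\<lambda>s. cond_law \<mu> s T B) - time_sum I T (\<lambda>s. cond_law \<mu>' s T B)\<bar>
        \<le> time_sum I T (\<lambda>s. C * exp (- \<kappa> * s))"
    proof (rule time_sum_diff_le[OF T(1)])
      show "time_summable I T (\<lambda>s. C * exp (- \<kappa> * s))"
        by (intro time_summable_continuous continuous_intros)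
      fix s assume "s \<in> I" "s \<le> T"
      then show "\<bar>cond_law \<mu> s T B - cond_law \<mu>' s T B\<bar> \<le> C * exp (- \<kappa> * s)"
        using shift[OF mu _ T(1) _ borel_sets_E[OF B], of s 0] by simp
    qed (intro cond_law_summable mu T B)+
    also have "\<dots> = C * time_sum I T (\<lambda>s. exp (- \<kappa> * s))"
      by (simp add: time_sum_def sum_distrib_left)
    also have "\<dots> \<le> C * K0" using K0(2)[OF T(1)] \<kappa> by (intro mult_left_mono) auto
    finally have "\<bar>time_sum I T (\<lambda>s. cond_law \<mu> s T B) - time_sum I T (\<lambda>s. cond_law \<mu>' s T B)\<bar> / T \<le> C * K0 / T"
      using pos by (intro divide_right_mono) auto
    then show ?thesis
      unfolding M_def time_average_measure(3)[OF mu(1) T(1) pos B]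
        time_average_measure(3)[OF mu(2) T(1) pos B] diff_divide_distrib[symmetric] abs_divide
      using pos by simp
  qed
  \<comment> \<open>\<open>\<nu> 0\<close> is the reference law: the hypotheses supply it as an
    admissible initial distribution.\<close>
  have nu0: "\<nu> 0 \<in> prob_measures_on E (- A 0)" by (rule nu) simp
  \<comment> \<open>Integer times belong to both time sets; the offset makes all of them at least
    \<open>\<gamma>\<close>, as the Cauchy estimate requires.\<close>
  define N where "N = nat \<lceil>\<gamma>\<rceil>"
  have N: "\<gamma> \<le> real (n + N)" "0 < real (n + N)" for n
    using gamma by (auto simp: N_def intro: order_trans[OF real_nat_ceiling_ge]) linarith+
  have to_0: "(\<lambda>n. K / real (n + N)) \<longlonglongrightarrow> 0" for K
    using LIMSEQ_ignore_initial_segment[OF lim_const_over_n[of K]] .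
  obtain \<beta> where \<beta>: "prob_space \<beta>" "sets \<beta> = sets borel"
    "\<And>n B. B \<in> sets borel \<Longrightarrow> \<bar>measure (M (\<nu> 0) (real (n + N))) B - measure \<beta> B\<bar> \<le> K1 / real (n + N)"
  proof (rule uniform_setwise_limit[of "\<lambda>n. M (\<nu> 0) (real (n + N))" borel "\<lambda>n. K1 / real (n + N)"])
    show "finite_measure (M (\<nu> 0) (real (n + N)))" "sets (M (\<nu> 0) (real (n + N))) = sets borel" for n
      unfolding M_def by (intro time_average_measure nu0 time_real N)+
    show "\<bar>measure (M (\<nu> 0) (real (m + N))) B - measure (M (\<nu> 0) (real (n + N))) B\<bar>
        \<le> K1 / real (m + N) + K1 / real (n + N)" if "B \<in> sets borel" for m n B
      by (intro Cauchy nu0 time_real N that)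
    show "(\<lambda>n. K1 / real (n + N)) \<longlonglongrightarrow> 0" by (rule to_0)
    have "(\<lambda>n. if I = \<nat> then 1 + 1 / real (n + N) else 1) \<longlonglongrightarrow> (1::real)"
      using tendsto_add[OF tendsto_const to_0[of 1], of 1] by (cases "I = \<nat>") simp_all
    then show "(\<lambda>n. measure (M (\<nu> 0) (real (n + N))) (space borel)) \<longlonglongrightarrow> 1"
      unfolding M_def space_borel by (subst time_average_mass[OF nu0 time_real N(2)])
  qed blast
  \<comment> \<open>\<open>C * K0\<close> pays for changing the initial law and \<open>K1\<close>
    for the Cauchy estimate at \<open>T\<close>; the two remaining errors at the integer time
    disappear as that time tends to infinity.\<close>
  have "\<bar>measure (M \<mu> T) B - measure \<beta> B\<bar> \<le> (C * K0 + K1) / T"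
    if mu: "\<mu> \<in> prob_measures_on E (- A 0)" and T: "T \<in> I" "\<gamma> \<le> T" and B: "B \<in> sets borel" for \<mu> T B
  proof -
    have "\<bar>measure (M \<mu> T) B - measure \<beta> B\<bar> \<le> C * K0 / T + K1 / T + 2 * (K1 / real (n + N))" for n
      using initial[OF mu nu0 T B] Cauchy[OF nu0 T(1) time_real T(2) N(1) B, of n] \<beta>(3)[OF B, of n]
      by linarith
    moreover have "(\<lambda>n. C * K0 / T + K1 / T + 2 * (K1 / real (n + N))) \<longlonglongrightarrow> C * K0 / T + K1 / T + 2 * 0"
      by (intro tendsto_intros to_0)
    ultimately have "\<bar>measure (M \<mu> T) B - measure \<beta> B\<bar> \<le> C * K0 / T + K1 / T + 2 * 0"
      by (intro LIMSEQ_le_const) auto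
    then show ?thesis by (simp add: add_divide_distrib)
  qed
  from this[unfolded M_def] show thesis by (rule that[OF \<beta>(1,2)])
qed

lemma time_average_weak_limit:
  obtains \<beta> where "prob_space \<beta>" "sets \<beta> = sets borel"
    "\<And>\<mu>. \<mu> \<in> prob_measures_on E (- A 0) \<Longrightarrow>
      converges_weakly (time_average I A X (\<mu> \<bind> P 0)) \<beta> (inf at_top (principal I))"
proof -
  obtain \<beta> K where \<beta>: "prob_space \<beta>" "sets \<beta> = sets borel"
    and K: "\<And>\<mu> T B. \<mu> \<in> prob_measures_on E (- A 0) \<Longrightarrow> T \<in> I \<Longrightarrow> \<gamma> \<le> T \<Longrightarrow> B \<in> sets borel \<Longrightarrow>
      \<bar>measure (time_average I A X (\<mu> \<bind> P 0) T) B - measure \<beta> B\<bar> \<le> K / T"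
    by (rule time_average_setwise_limit) blast
  show thesis
  proof (rule that[OF \<beta>])
    fix \<mu> assume mu: "\<mu> \<in> prob_measures_on E (- A 0)"
    let ?M = "time_average I A X (\<mu> \<bind> P 0)"
    show "converges_weakly ?M \<beta> (inf at_top (principal I))"
      unfolding converges_weakly_def
    proof (intro allI impI)
      fix f :: "'a \<Rightarrow> real" assume f: "continuous_on UNIV f" "bounded (range f)"
      obtain b where b: "\<And>x. \<bar>f x\<bar> \<le> b"
        using f(2) by (auto simp: bounded_iff)
      have f_meas: "f \<in> borel_measurable \<beta>"
        using borel_measurable_continuous_onI[OF f(1)] \<beta>(2) by (simp cong: measurable_cong_sets)
      have le: "norm ((\<integral>x. f x \<partial>?M T) - (\<integral>x. f x \<partial>\<beta>)) \<le> 3 * (b + 1) * (K / T)" if T: "\<gamma> \<le> T" "T \<in> I" for T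
      proof -
        have "0 < T" using T gamma by simp
        then show ?thesis
          using integral_diff_le_setwise_bounded[OF time_average_measure(2)[OF mu T(2)]
              prob_space.finite_measure[OF \<beta>(1)] _ _ f_meas b, of "K / T"]
            time_average_measure(1)[OF mu T(2)] K[OF mu T(2,1)] \<beta>(2) by simp
      qed
      have "((\<lambda>T. 3 * (b + 1) * (K / T)) \<longlongrightarrow> 3 * (b + 1) * 0) at_top"
        by (intro tendsto_intros tendsto_divide_0[OF tendsto_const] filterlim_at_top_imp_at_infinity filterlim_ident)
      then have "((\<lambda>T. 3 * (b + 1) * (K / T)) \<longlongrightarrow> 0) (inf at_top (principal I))"
        by (auto intro: tendsto_mono[OF inf_le1])
      moreover have "eventually (\<lambda>T. norm ((\<integral>x. f x \<partial>?M T) - (\<integral>x. f x \<partial>\<beta>)) \<le> 3 * (b + 1) * (K / T)) (inf at_top (principal I))"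
        unfolding eventually_inf_principal using eventually_ge_at_top[of \<gamma>] by eventually_elim (use le in auto)
      ultimately have "((\<lambda>T. (\<integral>x. f x \<partial>?M T) - (\<integral>x. f x \<partial>\<beta>)) \<longlongrightarrow> 0) (inf at_top (principal I))"
        by (rule Lim_null_comparison[rotated])
      then show "((\<lambda>T. \<integral>x. f x \<partial>?M T) \<longlongrightarrow> (\<integral>x. f x \<partial>\<beta>)) (inf at_top (principal I))"
        by (simp add: LIM_zero_iff)
    qed
  qed
qed

text \<open>The integers lie in \<open>I\<close> and tend to infinity, so both weak limits can be
  tested along one sequence.\<close>

lemma weak_limit_unique:
  fixes \<beta> \<beta>' :: "'a measure"
  assumes "prob_space \<beta>" "sets \<beta> = sets borel" "prob_space \<beta>'" "sets \<beta>' = sets borel"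
    and "converges_weakly m \<beta> (inf at_top (principal I))" "converges_weakly m \<beta>' (inf at_top (principal I))"
  shows "\<beta> = \<beta>'"
proof (rule borel_measure_eqI_continuous[OF assms(1-4)])
  fix f :: "'a \<Rightarrow> real" assume f: "continuous_on UNIV f" "bounded (range f)"
  have "filterlim real (inf at_top (principal I)) sequentially"
    unfolding filterlim_inf filterlim_principal
    using filterlim_real_sequentially time_real by auto
  note conv = filterlim_compose[OF _ this]
  have "(\<lambda>n. \<integral>x. f x \<partial>m (real n)) \<longlonglongrightarrow> (\<integral>x. f x \<partial>\<beta>)" "(\<lambda>n. \<integral>x. f x \<partial>m (real n)) \<longlonglongrightarrow> (\<integral>x. f x \<partial>\<beta>')"
    using assms(5,6) f unfolding converges_weakly_def by (auto intro: conv)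
  then show "(\<integral>x. f x \<partial>\<beta>) = (\<integral>x. f x \<partial>\<beta>')" by (rule LIMSEQ_unique)
qed

end

theorem theorem2:
  fixes I :: "real set"
    and E :: "'a::metric_space measure"
    and \<Omega> :: "'w measure"
    and X :: "real \<Rightarrow> 'w \<Rightarrow> 'a"
    and P :: "real \<Rightarrow> 'a \<Rightarrow> 'w measure"
    and A :: "real \<Rightarrow> 'a set"
    and \<nu> :: "real \<Rightarrow> 'a measure"
    and \<gamma> t0 c1 c2 :: real
  assumes process: "absorbed_markov_process I E \<Omega> X P A"
    and time_integrals: "\<And>\<mu> t B. I = {0..} \<Longrightarrow> \<mu> \<in> prob_measures_on E (- A 0) \<Longrightarrow> t \<in> I \<Longrightarrow>
      B \<in> sets borel \<Longrightarrow>
      (\<lambda>s. cond_marginal I A X (\<mu> \<bind> P 0) 0 s t B) \<in> borel_measurable (lebesgue_on {0..t})"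
    and gamma: "\<gamma> \<in> I" "\<gamma> > 0"
    and periodic: "\<And>t. t \<in> I \<Longrightarrow> A (t + \<gamma>) = A t"
    and nu: "\<And>s. s \<in> I \<Longrightarrow> \<nu> s \<in> prob_measures_on E (- A s)"
    and t0: "t0 \<in> I" "t0 > 0"
    and c1: "c1 > 0"
    and c2: "c2 > 0"
    and A'1: "\<And>s x B. s \<in> I \<Longrightarrow> x \<in> - A s \<Longrightarrow> B \<in> sets E \<Longrightarrow>
      cond_marginal I A X (P s x) s (s + t0) (s + t0) B \<ge> c1 * measure (\<nu> (s + t0)) B"
    and A'2: "\<And>s t x. s \<in> I \<Longrightarrow> t \<in> I \<Longrightarrow> s \<le> t \<Longrightarrow> x \<in> - A s \<Longrightarrow>
      \<P>(\<omega> in \<nu> s \<bind> P s. absorption_time I A X s \<omega> > ereal t)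
        \<ge> c2 * \<P>(\<omega> in P s x. absorption_time I A X s \<omega> > ereal t)"
  shows "\<exists>!\<beta>. \<beta> \<in> space (prob_algebra (borel :: 'a measure)) \<and>
    (\<forall>\<mu> \<in> prob_measures_on E (- A 0).
       converges_weakly (time_average I A X (\<mu> \<bind> P 0)) \<beta> (inf at_top (principal I)))"
proof -
  interpret absorbed_markov_process I E \<Omega> X P A by (rule process)
  interpret averaged_doeblin_process I E \<Omega> X P A \<nu> t0 c1 c2 \<gamma>
    by unfold_locales (fact nu t0 c1 c2 A'1 A'2 gamma periodic time_integrals)+
  obtain \<beta> where \<beta>: "prob_space \<beta>" "sets \<beta> = sets borel"
    "\<And>\<mu>. \<mu> \<in> prob_measures_on E (- A 0) \<Longrightarrow>
      converges_weakly (time_average I A X (\<mu> \<bind> P 0)) \<beta> (inf at_top (principal I))"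
    by (rule time_average_weak_limit) blast
  \<comment> \<open>Uniqueness needs at least one admissible initial law, since otherwise every
    \<open>\<beta>\<close> would satisfy the condition vacuously.\<close>
  have nu0: "\<nu> 0 \<in> prob_measures_on E (- A 0)" by (rule nu) simp
  show ?thesis
  proof (rule ex1I[of _ \<beta>])
    show "\<beta> \<in> space (prob_algebra borel) \<and> (\<forall>\<mu> \<in> prob_measures_on E (- A 0).
        converges_weakly (time_average I A X (\<mu> \<bind> P 0)) \<beta> (inf at_top (principal I)))"
      using \<beta> by (simp add: space_prob_algebra)
  next
    fix \<beta>' :: "'a measure"
    assume "\<beta>' \<in> space (prob_algebra borel) \<and> (\<forall>\<mu> \<in> prob_measures_on E (- A 0).
        converges_weakly (time_average I A X (\<mu> \<bind> P 0)) \<beta>' (inf at_top (principal I)))"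
    then show "\<beta>' = \<beta>"
      using \<beta> nu0 by (intro weak_limit_unique[of \<beta>' \<beta>]) (auto simp: space_prob_algebra)
  qed
qed

end
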